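(* Let $R/C$ be the set of $C$-orbits in $R$. Then for a simple root system $\Pi$ compatible with $C$ the map $I\to R/C$, $i\mapsto (C\text{-orbit of }\beta_i^\Pi)$, is a bijection, and this bijection does not depend on the choice of the simple root system $\Pi$ compatible with $C$.
   Context: $R\subset E$ is a reduced, irreducible, simply-laced root system (type $A,D,E$) of rank $r$ in a Euclidean space $E$ with $W$-invariant inner product $(\cdot,\cdot)$ normalized so that $(\alpha,\alpha)=2$ for $\alpha\in R$; $W$ is its Weyl group. A simple root system $\Pi\subset R$ is a base of $R$. There is a fixed index set $I$ and, for each simple root system $\Pi$, a bijection $I\to\Pi$, $i\mapsto\alpha_i^\Pi$, such that $w(\alpha_i^\Pi)=\alpha_i^{w(\Pi)}$ for all $w\in W$. For $i\ne j$ put $n_{ij}=-(\alpha_i^\Pi,\alpha_j^\Pi)\in\{0,1\}$ (independent of $\Pi$); $I$ also denotes the Dynkin diagram, the graph with vertex set $I$ and $n_{ij}$ edges between $i$ and $j$. Let $s_i^\Pi$ be the reflection in $\alpha_i^\Pi$. A Coxeter element is a product, in some order, of all the simple reflections of some simple root system, each taken once. A Coxeter element $C$ is fixed. $\Pi$ is compatible with $C$ if $C=s^\Pi_{i_1}\cdots s^\Pi_{i_r}$ for some enumeration $i_1,\dots,i_r$ of $I$. For compatible $\Pi$, the orientation $\Omega_\Pi$ of $I$ is: for $n_{ij}=1$, $i\to j$ if $s_i^\Pi$ precedes $s_j^\Pi$ in such an expression for $C$ (independent of the expression). Write $i\leqslant j$ if there is an oriented path (possibly of length $0$) from $i$ to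 $j$ in $\Omega_\Pi$, and set $\beta_i^\Pi=\sum_{j\leqslant i}\alpha_j^\Pi$ (these are roots). *)

theory Defs
  imports "HOL-Analysis.Analysis"
begin

definition reflection :: "'a::real_inner \<Rightarrow> 'a \<Rightarrow> 'a" where
  "reflection \<alpha> v = v - (2 * (v \<bullet> \<alpha>) / (\<alpha> \<bullet> \<alpha>)) *\<^sub>R \<alpha>"

definition root_system :: "'a::euclidean_space set \<Rightarrow> bool" where
  "root_system R \<longleftrightarrow>
     finite R \<and> 0 \<notin> R \<and> span R = UNIV \<and>
     (\<forall>\<alpha>\<in>R. reflection \<alpha> ` R = R) \<and>
     (\<forall>\<alpha>\<in>R. \<forall>\<beta>\<in>R. 2 * (\<beta> \<bullet> \<alpha>) / (\<alpha> \<bullet> \<alpha>) \<in> \<int>)"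

definition reduced_roots :: "'a::euclidean_space set \<Rightarrow> bool" where
  "reduced_roots R \<longleftrightarrow> (\<forall>\<alpha>\<in>R. \<forall>c::real. c *\<^sub>R \<alpha> \<in> R \<longrightarrow> c = 1 \<or> c = -1)"

definition irreducible_roots :: "'a::euclidean_space set \<Rightarrow> bool" where
  "irreducible_roots R \<longleftrightarrow>
     R \<noteq> {} \<and>
     \<not> (\<exists>A B. A \<noteq> {} \<and> B \<noteq> {} \<and> A \<inter> B = {} \<and> A \<union> B = R \<and>
            (\<forall>\<alpha>\<in>A. \<forall>\<beta>\<in>B. \<alpha> \<bullet> \<beta> = 0))"

text \<open>For reduced irreducible root systems this singles out the types A, D and E.\<close>
definition simply_laced :: "'a::euclidean_space set \<Rightarrow> bool" where
  "simply_laced R \<longleftrightarrow>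
     (\<forall>\<alpha>\<in>R. \<forall>\<beta>\<in>R. \<beta> \<noteq> \<alpha> \<longrightarrow> \<beta> \<noteq> - \<alpha> \<longrightarrow>
        2 * (\<beta> \<bullet> \<alpha>) / (\<alpha> \<bullet> \<alpha>) \<in> {-1, 0, 1})"

text \<open>Reflections are involutions, so closing under composition with them yields the
  whole generated group, inverses included.\<close>
inductive_set weyl_group :: "'a::euclidean_space set \<Rightarrow> ('a \<Rightarrow> 'a) set"
  for R :: "'a set" where
  one: "id \<in> weyl_group R"
| mult: "\<alpha> \<in> R \<Longrightarrow> w \<in> weyl_group R \<Longrightarrow> reflection \<alpha> \<circ> w \<in> weyl_group R"

definition simple_system :: "'a::euclidean_space set \<Rightarrow> 'a set \<Rightarrow> bool" where
  "simple_system R \<Delta> \<longleftrightarrow>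
     \<Delta> \<subseteq> R \<and> independent \<Delta> \<and> span \<Delta> = UNIV \<and>
     (\<forall>\<beta>\<in>R. \<exists>c :: 'a \<Rightarrow> int. \<beta> = (\<Sum>\<alpha>\<in>\<Delta>. of_int (c \<alpha>) *\<^sub>R \<alpha>) \<and>
        ((\<forall>\<alpha>\<in>\<Delta>. c \<alpha> \<ge> 0) \<or> (\<forall>\<alpha>\<in>\<Delta>. c \<alpha> \<le> 0)))"

text \<open>\<open>lab \<Delta> i\<close> is the simple root \<open>\<alpha>\<^sub>i\<close> of the simple system \<open>\<Delta>\<close>;
  only its values at simple systems and \<open>i \<in> I\<close> matter.\<close>
definition labelling :: "'a::euclidean_space set \<Rightarrow> 'i set \<Rightarrow> ('a set \<Rightarrow> 'i \<Rightarrow> 'a) \<Rightarrow> bool" where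
  "labelling R I lab \<longleftrightarrow>
     (\<forall>\<Delta>. simple_system R \<Delta> \<longrightarrow> bij_betw (lab \<Delta>) I \<Delta>) \<and>
     (\<forall>\<Delta>. simple_system R \<Delta> \<longrightarrow>
        (\<forall>w\<in>weyl_group R. \<forall>i\<in>I. w (lab \<Delta> i) = lab (w ` \<Delta>) i))"

text \<open>\<open>refl_prod [\<alpha>\<^sub>1, \<dots>, \<alpha>\<^sub>k]\<close> is the composition of the reflections, the last one applied first.\<close>
definition refl_prod :: "'a::euclidean_space list \<Rightarrow> 'a \<Rightarrow> 'a" where
  "refl_prod \<alpha>s = foldr (\<circ>) (map reflection \<alpha>s) id"

definition coxeter_element :: "'a::euclidean_space set \<Rightarrow> ('a \<Rightarrow> 'a) \<Rightarrow> bool" where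
  "coxeter_element R C \<longleftrightarrow>
     (\<exists>\<Delta> \<alpha>s. simple_system R \<Delta> \<and> distinct \<alpha>s \<and> set \<alpha>s = \<Delta> \<and> C = refl_prod \<alpha>s)"

definition expression_for ::
    "'i set \<Rightarrow> ('a set \<Rightarrow> 'i \<Rightarrow> 'a) \<Rightarrow> ('a::euclidean_space \<Rightarrow> 'a) \<Rightarrow> 'a set \<Rightarrow> 'i list \<Rightarrow> bool" where
  "expression_for I lab C \<Delta> is \<longleftrightarrow>
     distinct is \<and> set is = I \<and> C = refl_prod (map (lab \<Delta>) is)"

definition compatible ::
    "'a::euclidean_space set \<Rightarrow> 'i set \<Rightarrow> ('a set \<Rightarrow> 'i \<Rightarrow> 'a) \<Rightarrow> ('a \<Rightarrow> 'a) \<Rightarrow> 'a set \<Rightarrow> bool" where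
  "compatible R I lab C \<Delta> \<longleftrightarrow>
     simple_system R \<Delta> \<and> (\<exists>is. expression_for I lab C \<Delta> is)"

text \<open>The number of edges between \<open>i \<noteq> j\<close> in the Dynkin diagram; it is 0 or 1.\<close>
definition dynkin_n :: "('a set \<Rightarrow> 'i \<Rightarrow> 'a) \<Rightarrow> 'a::euclidean_space set \<Rightarrow> 'i \<Rightarrow> 'i \<Rightarrow> real" where
  "dynkin_n lab \<Delta> i j = - (lab \<Delta> i \<bullet> lab \<Delta> j)"

definition precedes :: "'i list \<Rightarrow> 'i \<Rightarrow> 'i \<Rightarrow> bool" where
  "precedes is i j \<longleftrightarrow> (\<exists>p q. p < q \<and> q < length is \<and> is ! p = i \<and> is ! q = j)"

text \<open>For adjacent \<open>i\<close>, \<open>j\<close> the relative order of the two reflections is the same in all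
  expressions for \<open>C\<close>, so quantifying existentially over the expression is harmless.\<close>
definition orientation ::
    "'i set \<Rightarrow> ('a set \<Rightarrow> 'i \<Rightarrow> 'a) \<Rightarrow> ('a::euclidean_space \<Rightarrow> 'a) \<Rightarrow> 'a set \<Rightarrow> ('i \<times> 'i) set" where
  "orientation I lab C \<Delta> =
     {(i, j). i \<in> I \<and> j \<in> I \<and> i \<noteq> j \<and> dynkin_n lab \<Delta> i j = 1 \<and>
        (\<exists>is. expression_for I lab C \<Delta> is \<and> precedes is i j)}"

definition beta ::
    "'i set \<Rightarrow> ('a set \<Rightarrow> 'i \<Rightarrow> 'a) \<Rightarrow> ('a::euclidean_space \<Rightarrow> 'a) \<Rightarrow> 'a set \<Rightarrow> 'i \<Rightarrow> 'a" where
  "beta I lab C \<Delta> i = (\<Sum>j\<in>{j \<in> I. (j, i) \<in> (orientation I lab C \<Delta>)\<^sup>*}. lab \<Delta> j)"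

text \<open>The orbit of \<open>x\<close> under the cyclic group generated by the bijection \<open>C\<close>.\<close>
definition cyc_orbit :: "('a \<Rightarrow> 'a) \<Rightarrow> 'a \<Rightarrow> 'a set" where
  "cyc_orbit C x = {(C ^^ n) x | n. True} \<union> {(inv C ^^ n) x | n. True}"

definition orbit_set :: "'a set \<Rightarrow> ('a \<Rightarrow> 'a) \<Rightarrow> 'a set set" where
  "orbit_set R C = cyc_orbit C ` R"

end

theory Submission
  imports Defs
begin

text \<open>
  The roots \<open>\<beta>\<^sub>k = s\<^sub>1 \<cdots> s\<^sub>k\<^sub>-\<^sub>1 \<alpha>\<^sub>k\<close> equal \<open>(1 - C) \<omega>\<^sub>k\<close> for the dual basis \<open>\<omega>\<close> of the simple roots, so they
  depend only on \<open>C\<close> and the simple system. Reflecting the simple system in a source \<open>\<alpha>\<^sub>i\<close> keeps it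
  compatible, replaces \<open>\<beta>\<^sub>i\<close> by \<open>C \<beta>\<^sub>i\<close> and fixes the other \<open>\<beta>\<^sub>k\<close>; hence no orbit changes. Since the
  Dynkin diagram is a forest, such flips lead from any compatible system to a bipartite one.

  For a bipartite system the Perron vector of the diagram gives a linear map \<open>p\<close> to the complex plane
  with \<open>p (C v) = e\<^sup>2\<^sup>i\<^sup>\<phi> p v\<close> that sends the positive roots to the upper half plane. Every orbit
  crosses from negative to positive, which happens exactly at the \<open>\<beta>\<^sub>k\<close>. A Weyl group element that
  acts on the plane by a rotation and maps some \<open>\<beta>\<^sub>i\<close> to some \<open>\<beta>\<^sub>j\<close> permutes the simple roots, up to
  a reflection of the plane, and must be trivial: powers of \<open>C\<close> give injectivity. An element
  commuting with \<open>C\<close> acts on the plane by a scalar because the Perron eigenvalue is simple, so it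
  is a power of \<open>C\<close>, which gives independence of the simple system.
\<close>

section \<open>Reflections and the Weyl group\<close>

text \<open>Triviality of an element that permutes the simple roots comes from the labelling: by
  equivariance, a Weyl group element preserving a simple system fixes each of its roots, so no
  nontrivial diagram automorphism is realised in the group. The rotation angle enters only through
  the Perron eigenvalue \<open>2 * cos \<phi>\<close>, of which the bounds 0 and 2 are known, and
  the order of \<open>C\<close> through a pigeonhole argument. The obstacle in comparing two
  compatible systems is that a Weyl group element carrying one to the other need not commute with
  \<open>C\<close>, since the orientations can differ. It does commute once both systems are
  bipartite with the same colouring, because \<open>C\<close> is then given by one formula in the
  labelled simple roots. Hence both are flipped towards one common colouring, and this is why the
  height function that governs the flips has its parity prescribed in advance.\<close>

lemma orthogonal_transformation_reflection:
  "orthogonal_transformation (reflection (\<alpha> :: 'a::real_inner))"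
proof (cases "\<alpha> = 0")
  case True
  then have "reflection \<alpha> = (\<lambda>v. v)" by (simp add: fun_eq_iff reflection_def)
  then show ?thesis by simp
next
  case False
  then have nz: "\<alpha> \<bullet> \<alpha> \<noteq> 0" by simp
  have "linear (reflection \<alpha>)"
    by (rule linearI) (simp_all add: reflection_def inner_add_left add_divide_distrib
        distrib_left scaleR_add_left scaleR_diff_right)
  moreover have "reflection \<alpha> v \<bullet> reflection \<alpha> w = v \<bullet> w" for v w
    using nz by (simp add: reflection_def inner_diff_left inner_diff_right inner_commute field_simps)
  ultimately show ?thesis by (simp add: orthogonal_transformation_def)
qed

lemma reflection_involution [simp]: "reflection \<alpha> (reflection \<alpha> v) = v"
  by (cases "\<alpha> \<bullet> \<alpha> = 0") (simp_all add: reflection_def inner_diff_left scaleR_add_left[symmetric])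

lemma reflection_orthogonal_image:
  assumes "orthogonal_transformation w"
  shows "reflection (w \<alpha>) (w v) = w (reflection \<alpha> v)"
  using assms by (simp add: reflection_def orthogonal_transformation_def linear_diff linear_scale)

lemma refl_prod_Nil [simp]: "refl_prod [] v = v"
  by (simp add: refl_prod_def)

lemma refl_prod_Cons [simp]: "refl_prod (\<alpha> # \<alpha>s) v = reflection \<alpha> (refl_prod \<alpha>s v)"
  by (simp add: refl_prod_def)

lemma refl_prod_append [simp]: "refl_prod (\<alpha>s @ \<beta>s) v = refl_prod \<alpha>s (refl_prod \<beta>s v)"
  by (induction \<alpha>s) simp_all

lemma refl_prod_Cons_comp: "refl_prod (\<alpha> # \<alpha>s) = reflection \<alpha> \<circ> refl_prod \<alpha>s"
  by auto

lemma orthogonal_transformation_refl_prod: "orthogonal_transformation (refl_prod \<alpha>s)"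
proof (induction \<alpha>s)
  case Nil
  have "refl_prod [] = (\<lambda>x::'a. x)" by auto
  then show ?case by simp
next
  case (Cons \<alpha> \<alpha>s)
  then show ?case
    unfolding refl_prod_Cons_comp
    by (intro orthogonal_transformation_compose orthogonal_transformation_reflection)
qed

text \<open>Product form of the rule that conjugation by \<open>w\<close> turns the reflection in
  \<alpha> into the one in \<open>w \<alpha>\<close>. When \<open>w\<close> fixes the vectors of the
  list, it says that \<open>w\<close> commutes with the product; both readings occur below.\<close>

lemma refl_prod_orthogonal_image:
  assumes "orthogonal_transformation w"
  shows "refl_prod (map (w \<circ> a) xs) (w v) = w (refl_prod (map a xs) v)"
  by (induction xs) (simp_all add: reflection_orthogonal_image[OF assms])

lemma refl_prod_fixes:
  assumes "\<And>i. i \<in> set xs \<Longrightarrow> v \<bullet> a i = 0"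
  shows "refl_prod (map a xs) v = v"
  using assms by (induction xs) (simp_all add: reflection_def)

lemma weyl_orthogonal: "w \<in> weyl_group R \<Longrightarrow> orthogonal_transformation w"
proof (induction rule: weyl_group.induct)
  case one
  then show ?case by (simp add: id_def)
next
  case (mult \<alpha> w)
  then show ?case
    by (intro orthogonal_transformation_compose orthogonal_transformation_reflection)
qed

lemma weyl_linear: "w \<in> weyl_group R \<Longrightarrow> linear w"
  by (simp add: orthogonal_transformation_linear weyl_orthogonal)

lemma weyl_inj: "w \<in> weyl_group R \<Longrightarrow> inj w"
  by (simp add: orthogonal_transformation_inj weyl_orthogonal)

lemma weyl_inner: "w \<in> weyl_group R \<Longrightarrow> w u \<bullet> w v = u \<bullet> v"
  using weyl_orthogonal by (auto simp: orthogonal_transformation_def)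

lemma weyl_comp: "u \<in> weyl_group R \<Longrightarrow> w \<in> weyl_group R \<Longrightarrow> u \<circ> w \<in> weyl_group R"
  by (induction rule: weyl_group.induct) (auto simp: comp_assoc intro: weyl_group.intros)

lemma weyl_reflection: "\<alpha> \<in> R \<Longrightarrow> reflection \<alpha> \<in> weyl_group R"
  using weyl_group.mult[OF _ weyl_group.one] by fastforce

lemma weyl_refl_prod: "set \<alpha>s \<subseteq> R \<Longrightarrow> refl_prod \<alpha>s \<in> weyl_group R"
proof (induction \<alpha>s)
  case Nil
  have "refl_prod [] = (id :: 'a \<Rightarrow> 'a)" by auto
  then show ?case by (metis weyl_group.one)
next
  case (Cons \<alpha> \<alpha>s)
  then show ?case unfolding refl_prod_Cons_comp by (intro weyl_group.mult) simp_all
qed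

lemma weyl_funpow: "w \<in> weyl_group R \<Longrightarrow> w ^^ n \<in> weyl_group R"
  by (induction n) (auto intro: weyl_group.one weyl_comp)

text \<open>For roots of norm 2 these are the fundamental weights. The choice sees \<open>a\<close>
  only on \<open>I\<close>, so two families that agree on \<open>I\<close> have literally the same
  dual basis.\<close>

definition dual_basis :: "'i set \<Rightarrow> ('i \<Rightarrow> 'a::euclidean_space) \<Rightarrow> 'i \<Rightarrow> 'a" where
  "dual_basis I a k = (SOME v. \<forall>j\<in>I. a j \<bullet> v = (if j = k then 1 else 0))"

locale sl_roots =
  fixes R :: "'a::euclidean_space set"
  assumes root_system: "root_system R"
    and laced: "simply_laced R"
    and norm2: "\<alpha> \<in> R \<Longrightarrow> \<alpha> \<bullet> \<alpha> = 2"
begin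

lemma finite_R: "finite R" and zero_notin: "0 \<notin> R" and span_R: "span R = UNIV"
  using root_system by (auto simp: root_system_def)

lemma reflection_root: "\<alpha> \<in> R \<Longrightarrow> reflection \<alpha> v = v - (v \<bullet> \<alpha>) *\<^sub>R \<alpha>"
  by (simp add: reflection_def norm2)

lemma reflection_closed: "\<alpha> \<in> R \<Longrightarrow> reflection \<alpha> ` R = R"
  using root_system by (auto simp: root_system_def)

lemma weyl_R: "w \<in> weyl_group R \<Longrightarrow> w ` R = R"
  by (induction rule: weyl_group.induct) (simp_all add: image_comp[symmetric] reflection_closed del: comp_apply image_image)

lemma weyl_in_R: "w \<in> weyl_group R \<Longrightarrow> x \<in> R \<Longrightarrow> w x \<in> R"
  using weyl_R by blast

lemma uminus_root: "\<alpha> \<in> R \<Longrightarrow> - \<alpha> \<in> R"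
  using weyl_in_R[OF weyl_reflection, of \<alpha> \<alpha>] by (simp add: reflection_root norm2 scaleR_2)

lemma root_inner: "\<alpha> \<in> R \<Longrightarrow> \<beta> \<in> R \<Longrightarrow> \<beta> \<noteq> \<alpha> \<Longrightarrow> \<beta> \<noteq> - \<alpha> \<Longrightarrow> \<beta> \<bullet> \<alpha> \<in> {-1, 0, 1}"
  using laced norm2[of \<alpha>] unfolding simply_laced_def by fastforce

lemma root_inner_Ints: "\<alpha> \<in> R \<Longrightarrow> \<beta> \<in> R \<Longrightarrow> \<beta> \<bullet> \<alpha> \<in> \<int>"
  using root_inner[of \<alpha> \<beta>] norm2[of \<alpha>] by (cases "\<beta> = \<alpha>"; cases "\<beta> = - \<alpha>") auto

text \<open>The powers of \<open>w\<close> restrict to self-maps of the finite set \<open>R\<close>,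
  so two of them agree there; cancelling the smaller one gives a power that is the identity on a
  spanning set.\<close>

lemma weyl_finite_order:
  assumes w: "w \<in> weyl_group R"
  obtains N where "N > 0" "w ^^ N = id"
proof -
  define r where "r n = restrict (w ^^ n) R" for n
  have "range r \<subseteq> R \<rightarrow>\<^sub>E R"
    using weyl_in_R[OF weyl_funpow[OF w]] by (auto simp: r_def)
  moreover have "finite (R \<rightarrow>\<^sub>E R)" by (intro finite_PiE finite_R)
  ultimately have "\<not> inj r"
    using finite_imageD[of r UNIV] finite_subset by (auto simp: inj_on_def[symmetric])
  then obtain m n where mn: "m < n" "r m = r n"
    unfolding inj_on_def by (metis linorder_neqE_nat)
  have "(w ^^ (n - m)) x = id x" for x
  proof (rule linear_eq_on_span[of "w ^^ (n - m)" id R])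
    show "linear (w ^^ (n - m))" by (rule weyl_linear[OF weyl_funpow[OF w]])
    show "linear (id :: 'a \<Rightarrow> 'a)" by (simp add: linear_id)
    show "x \<in> span R" by (simp add: span_R)
    fix y assume y: "y \<in> R"
    have "(w ^^ m) ((w ^^ (n - m)) y) = (w ^^ n) y"
      using mn(1) by (metis add_diff_inverse_nat comp_apply funpow_add not_less_iff_gr_or_eq)
    also have "\<dots> = (w ^^ m) y"
      using mn(2) y by (metis r_def restrict_apply')
    finally show "(w ^^ (n - m)) y = id y"
      using weyl_inj[OF weyl_funpow[OF w, of m]] by (simp add: inj_eq)
  qed
  then have "w ^^ (n - m) = id" by (rule ext)
  then show ?thesis using that[of "n - m"] mn(1) by simp
qed

end

section \<open>Cyclic orbits of a map of finite order\<close>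

lemma funpow_inverse:
  assumes N: "N > 0" "C ^^ N = id"
  shows "inv C = C ^^ (N - 1)"
proof (rule inv_unique_comp)
  have "Suc (N - 1) = N" using N(1) by simp
  then show "C \<circ> C ^^ (N - 1) = id" "C ^^ (N - 1) \<circ> C = id"
    using N(2) by (metis funpow.simps(2), metis funpow_Suc_right)
qed

lemma cyc_orbit_finite_order:
  assumes N: "N > 0" "C ^^ N = id"
  shows "cyc_orbit C x = {(C ^^ n) x | n. True}"
proof -
  have "\<exists>m. (inv C ^^ n) x = (C ^^ m) x" for n
    by (metis funpow_inverse[OF N] funpow_mult)
  then show ?thesis unfolding cyc_orbit_def by auto
qed

lemma cyc_orbit_eq:
  assumes N: "N > 0" "C ^^ N = id" and y: "y = (C ^^ n) x"
  shows "cyc_orbit C y = cyc_orbit C x"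
proof -
  \<comment> \<open>Since \<open>(N - 1) * n + n\<close> is a multiple of \<open>N\<close>, this
    many further steps undo \<open>C ^^ n\<close>.\<close>
  have "(C ^^ ((N - 1) * n)) y = x"
  proof -
    have "(C ^^ ((N - 1) * n)) y = (C ^^ (N * n)) x"
    proof -
      have "(N - 1) * n + n = N * n" using N(1) by (cases N) auto
      then show ?thesis by (metis y comp_apply funpow_add)
    qed
    also have "\<dots> = ((C ^^ N) ^^ n) x" by (simp add: funpow_mult)
    also have "\<dots> = x" by (simp add: N(2))
    finally show ?thesis .
  qed
  then have "x = (C ^^ ((N - 1) * n)) y" by simp
  then show ?thesis
    unfolding cyc_orbit_finite_order[OF N] using y
    by (auto simp del: funpow.simps) (metis comp_apply funpow_add)+
qed

section \<open>Simple roots and the Dynkin forest\<close>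

text \<open>The indexing \<open>a\<close> is a free parameter rather than a value of the labelling,
  so that \<open>w \<circ> a\<close> is again an instance over the same \<open>I\<close>.\<close>

locale simple_base = sl_roots R for R :: "'a::euclidean_space set" +
  fixes I :: "'i set" and a :: "'i \<Rightarrow> 'a"
  assumes inj_a: "inj_on a I" and simple: "simple_system R (a ` I)"
begin

abbreviation \<omega> where "\<omega> \<equiv> dual_basis I a"

lemma a_in_R: "i \<in> I \<Longrightarrow> a i \<in> R"
  using simple by (auto simp: simple_system_def)

lemma span_a: "span (a ` I) = UNIV" and independent_a: "independent (a ` I)"
  using simple by (auto simp: simple_system_def)

lemma finite_I: "finite I"
  using finite_subset[OF _ finite_R] simple inj_a finite_imageD
  unfolding simple_system_def by blast

lemma dual: "i \<in> I \<Longrightarrow> k \<in> I \<Longrightarrow> a i \<bullet> \<omega> k = (if i = k then 1 else 0)"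
proof -
  assume i: "i \<in> I" and k: "k \<in> I"
  obtain f :: "'a \<Rightarrow> real" where f: "linear f"
    "\<forall>x\<in>a ` I. f x = (if x = a k then 1 else 0)"
    using linear_independent_extend[OF independent_a, of "\<lambda>x. if x = a k then 1 else 0"] by blast
  \<comment> \<open>Riesz representation: \<open>v\<close> is the vector whose inner product is the
    coordinate functional \<open>f\<close>.\<close>
  define v where "v = (\<Sum>e\<in>Basis. f e *\<^sub>R e)"
  have "f x = x \<bullet> v" for x
  proof -
    have "f x = f (\<Sum>e\<in>Basis. (x \<bullet> e) *\<^sub>R e)" by (simp add: euclidean_representation)
    also have "\<dots> = (\<Sum>e\<in>Basis. (x \<bullet> e) * f e)"
      by (simp add: linear_sum[OF f(1)] linear_scale[OF f(1)])
    finally show ?thesis by (simp add: v_def inner_sum_right mult.commute)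
  qed
  then have "\<forall>j\<in>I. a j \<bullet> v = (if j = k then 1 else 0)"
    using f(2) k inj_a by (auto simp: inj_on_eq_iff)
  then have "\<forall>j\<in>I. a j \<bullet> \<omega> k = (if j = k then 1 else 0)"
    unfolding dual_basis_def by (rule someI[of "\<lambda>v. \<forall>j\<in>I. a j \<bullet> v = (if j = k then 1 else 0)"])
  then show ?thesis using i by blast
qed

lemma sum_dual: "k \<in> I \<Longrightarrow> (\<Sum>i\<in>I. c i *\<^sub>R a i) \<bullet> \<omega> k = c k"
proof -
  assume k: "k \<in> I"
  have "(\<Sum>i\<in>I. c i *\<^sub>R a i) \<bullet> \<omega> k = (\<Sum>i\<in>I. if i = k then c i else 0)"
    unfolding inner_sum_left using k by (intro sum.cong) (auto simp: dual)
  then show ?thesis using k finite_I by simp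
qed

lemma linear_eqI:
  assumes "linear f" "linear g" "\<And>i. i \<in> I \<Longrightarrow> f (a i) = g (a i)"
  shows "f v = g v"
proof (rule linear_eq_on_span[OF assms(1,2)])
  show "v \<in> span (a ` I)" by (simp add: span_a)
qed (use assms(3) in blast)

lemma expand: "(\<Sum>i\<in>I. (v \<bullet> \<omega> i) *\<^sub>R a i) = v"
proof -
  let ?f = "\<lambda>v. \<Sum>i\<in>I. (v \<bullet> \<omega> i) *\<^sub>R a i"
  have "?f v = id v"
  proof (rule linear_eqI[of ?f id])
    show "linear (\<lambda>v. \<Sum>i\<in>I. (v \<bullet> \<omega> i) *\<^sub>R a i)"
      by (rule linearI) (simp_all add: inner_add_left scaleR_add_left sum.distrib scaleR_sum_right)
    fix j assume "j \<in> I"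
    then have "(\<Sum>i\<in>I. (a j \<bullet> \<omega> i) *\<^sub>R a i) = (\<Sum>i\<in>I. if i = j then a i else 0)"
      by (intro sum.cong) (auto simp: dual)
    then show "(\<Sum>i\<in>I. (a j \<bullet> \<omega> i) *\<^sub>R a i) = id (a j)"
      using \<open>j \<in> I\<close> finite_I by simp
  qed (simp add: linear_id)
  then show ?thesis by simp
qed

lemma inner_a_eqI: "(\<And>i. i \<in> I \<Longrightarrow> a i \<bullet> u = a i \<bullet> v) \<Longrightarrow> u = v"
  using linear_eqI[of "\<lambda>x. x \<bullet> u" "\<lambda>x. x \<bullet> v"]
  by (metis bounded_linear.linear bounded_linear_inner_left vector_eq_ldot)

lemma coord_eqI: "(\<And>i. i \<in> I \<Longrightarrow> u \<bullet> \<omega> i = v \<bullet> \<omega> i) \<Longrightarrow> u = v"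
  by (metis (no_types, lifting) expand sum.cong)

lemma root_coords:
  assumes "x \<in> R"
  shows "(\<forall>i\<in>I. x \<bullet> \<omega> i \<in> \<int>) \<and> ((\<forall>i\<in>I. x \<bullet> \<omega> i \<ge> 0) \<or> (\<forall>i\<in>I. x \<bullet> \<omega> i \<le> 0))"
proof -
  obtain c :: "'a \<Rightarrow> int" where c: "x = (\<Sum>\<alpha>\<in>a ` I. of_int (c \<alpha>) *\<^sub>R \<alpha>)"
    "(\<forall>\<alpha>\<in>a ` I. c \<alpha> \<ge> 0) \<or> (\<forall>\<alpha>\<in>a ` I. c \<alpha> \<le> 0)"
    using simple assms unfolding simple_system_def by blast
  have "x = (\<Sum>i\<in>I. of_int (c (a i)) *\<^sub>R a i)"
    using c(1) by (simp add: sum.reindex[OF inj_a])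
  then have "x \<bullet> \<omega> i = of_int (c (a i))" if "i \<in> I" for i
    using that sum_dual[of i "\<lambda>i. of_int (c (a i))"] by simp
  then show ?thesis using c(2) by auto
qed

lemmas root_coord_Ints = root_coords[THEN conjunct1, rule_format]

definition pos :: "'a \<Rightarrow> bool" where "pos x \<longleftrightarrow> (\<forall>i\<in>I. x \<bullet> \<omega> i \<ge> 0)"

lemma pos_cases: "x \<in> R \<Longrightarrow> pos x \<or> pos (- x)"
  using root_coords by (auto simp: pos_def)

lemma root_not_pos: "x \<in> R \<Longrightarrow> \<not> pos x \<longleftrightarrow> pos (- x)"
proof -
  assume x: "x \<in> R"
  have "x = 0" if "pos x" "pos (- x)"
    by (rule coord_eqI) (use that in \<open>auto simp: pos_def intro: antisym\<close>)
  then show ?thesis using pos_cases[OF x] x zero_notin by blast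
qed

text \<open>The coordinates of a root share one sign, so a single positive coordinate
  decides.\<close>

lemma posI: "x \<in> R \<Longrightarrow> i \<in> I \<Longrightarrow> x \<bullet> \<omega> i > 0 \<Longrightarrow> pos x"
  using root_coords[of x] by (force simp: pos_def)

lemma pos_a: "i \<in> I \<Longrightarrow> pos (a i)"
  by (simp add: pos_def dual)

text \<open>Inner product 1 would make \<open>a i - a j\<close> a root with coordinates of both
  signs.\<close>

lemma simple_inner:
  assumes "i \<in> I" "j \<in> I" "i \<noteq> j"
  shows "a i \<bullet> a j = 0 \<or> a i \<bullet> a j = - 1"
proof -
  have ne: "a i \<noteq> a j" using assms inj_a by (auto simp: inj_on_eq_iff)
  have ne': "a i \<noteq> - a j"
    using pos_a[OF assms(1)] pos_a[OF assms(2)] root_not_pos[OF a_in_R[OF assms(2)]] by metis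
  have "a i \<bullet> a j \<noteq> 1"
  proof
    assume 1: "a i \<bullet> a j = 1"
    have r: "a i - a j \<in> R"
      using weyl_in_R[OF weyl_reflection[OF a_in_R[OF assms(2)]] a_in_R[OF assms(1)]] 1
      by (simp add: reflection_root a_in_R assms)
    have "pos (a i - a j)" using r assms(1)
      by (rule posI) (use assms in \<open>simp add: inner_diff_left dual\<close>)
    then show False using assms(2,3) assms(1) by (force simp: pos_def inner_diff_left dual)
  qed
  then show ?thesis
    using root_inner[OF a_in_R[OF assms(2)] a_in_R[OF assms(1)] ne ne'] by auto
qed

lemma a_norm2: "i \<in> I \<Longrightarrow> a i \<bullet> a i = 2"
  by (simp add: a_in_R norm2)

text \<open>Pairing \<open>x\<close> with an \<open>a j\<close> in its support leaves only the term
  \<open>2 * (x \<bullet> \<omega> j)\<close>, which is at least 2, whereas distinct non-opposite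
  roots have inner product at most 1. This later recognises the roots on the boundary rays of the
  Coxeter plane as simple.\<close>

lemma root_on_orthogonal_simples:
  assumes x: "x \<in> R" "pos x" and J: "J \<subseteq> I"
    and off: "\<And>i. i \<in> I - J \<Longrightarrow> x \<bullet> \<omega> i = 0"
    and orth: "\<And>i j. i \<in> J \<Longrightarrow> j \<in> J \<Longrightarrow> i \<noteq> j \<Longrightarrow> a i \<bullet> a j = 0"
  shows "\<exists>j\<in>J. x = a j"
proof -
  have "\<exists>j\<in>I. x \<bullet> \<omega> j \<noteq> 0"
    using coord_eqI[of x 0] x(1) zero_notin by auto
  then obtain j where j: "j \<in> J" "x \<bullet> \<omega> j \<noteq> 0" "j \<in> I" using off by auto
  have "x \<bullet> \<omega> j > 0" using j x(2) by (force simp: pos_def)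
  then have ge1: "x \<bullet> \<omega> j \<ge> 1"
    using root_coord_Ints[OF x(1) j(3)] by (auto elim!: Ints_cases)
  have "x \<bullet> a j = (\<Sum>i\<in>I. (x \<bullet> \<omega> i) *\<^sub>R a i) \<bullet> a j" by (simp add: expand)
  also have "\<dots> = (\<Sum>i\<in>I. if i = j then 2 * (x \<bullet> \<omega> j) else 0)"
    unfolding inner_sum_left
  proof (rule sum.cong[OF refl])
    fix i assume i: "i \<in> I"
    show "(x \<bullet> \<omega> i) *\<^sub>R a i \<bullet> a j = (if i = j then 2 * (x \<bullet> \<omega> j) else 0)"
    proof (cases "i \<in> J")
      case True
      then show ?thesis using orth[OF True j(1)] a_norm2[OF i] by auto
    next
      case False
      then have "x \<bullet> \<omega> i = 0" "i \<noteq> j" using off i j(1) by auto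
      then show ?thesis by simp
    qed
  qed
  finally have xj: "x \<bullet> a j = 2 * (x \<bullet> \<omega> j)" using j finite_I by simp
  have "x = a j"
  proof (rule ccontr)
    assume ne: "x \<noteq> a j"
    show False
    proof (cases "x = - a j")
      case True
      then show ?thesis using xj ge1 by (simp add: dual j a_norm2)
    next
      case False
      then show ?thesis using root_inner[OF a_in_R[OF j(3)] x(1) ne] xj ge1 by auto
    qed
  qed
  then show ?thesis using j by blast
qed

text \<open>The root lattice is even: adding a multiple of \<open>a k\<close> changes the norm by
  twice a square plus twice an integral inner product.\<close>

lemma even_norm:
  assumes "\<And>i. i \<in> S \<Longrightarrow> c i \<in> \<int>" "S \<subseteq> I"
  shows "\<exists>n::int. (\<Sum>i\<in>S. c i *\<^sub>R a i) \<bullet> (\<Sum>i\<in>S. c i *\<^sub>R a i) = 2 * of_int n"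
  using finite_subset[OF assms(2) finite_I] assms
proof (induction S rule: finite_induct)
  case empty
  then show ?case by (intro exI[of _ 0]) simp
next
  case (insert k S)
  let ?u = "\<Sum>i\<in>S. c i *\<^sub>R a i"
  obtain n :: int where n: "?u \<bullet> ?u = 2 * of_int n" using insert by auto
  have "(c k *\<^sub>R a k) \<bullet> ?u \<in> \<int>"
    unfolding inner_sum_right using insert.prems
    by (intro Ints_sum) (auto intro!: Ints_mult root_inner_Ints a_in_R)
  then obtain m where m: "(c k *\<^sub>R a k) \<bullet> ?u = of_int m" by (elim Ints_cases)
  obtain l where l: "c k = of_int l" using insert.prems(1)[of k] by (auto elim!: Ints_cases)
  have "(\<Sum>i\<in>insert k S. c i *\<^sub>R a i) = c k *\<^sub>R a k + ?u"
    using insert.hyps by simp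
  then have "(\<Sum>i\<in>insert k S. c i *\<^sub>R a i) \<bullet> (\<Sum>i\<in>insert k S. c i *\<^sub>R a i)
      = (c k)^2 * 2 + 2 * ((c k *\<^sub>R a k) \<bullet> ?u) + ?u \<bullet> ?u"
    using insert.prems a_norm2[of k]
    by (simp add: inner_add_left inner_add_right power2_eq_square inner_commute)
  also have "\<dots> = 2 * of_int (l^2 + m + n)" using n m by (simp add: l)
  finally show ?case by blast
qed

text \<open>The norm of the sum of the simple roots in \<open>S\<close> is \<open>2 * card S\<close>
  minus the degree sum, and it is positive. So every induced subgraph has fewer edges than
  vertices.\<close>

lemma forest_degree:
  assumes "S \<subseteq> I" "S \<noteq> {}"
  shows "(\<Sum>i\<in>S. card {j \<in> S. a i \<bullet> a j = - 1}) < 2 * card S"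
proof -
  let ?u = "\<Sum>j\<in>S. a j"
  have fin: "finite S" using assms finite_I finite_subset by blast
  obtain k where k: "k \<in> S" using assms by auto
  have "?u = (\<Sum>j\<in>I. (if j \<in> S then 1 else 0) *\<^sub>R a j)"
    by (rule sum.mono_neutral_cong_left) (use assms(1) finite_I in auto)
  then have "?u \<bullet> \<omega> k = 1" using k assms(1) sum_dual[of k "\<lambda>j. if j \<in> S then 1 else 0"] by auto
  then have "?u \<noteq> 0" by auto
  then have "0 < ?u \<bullet> ?u" by simp
  also have "?u \<bullet> ?u = (\<Sum>i\<in>S. a i \<bullet> ?u)" by (simp add: inner_sum_left)
  also have "\<dots> = (\<Sum>i\<in>S. 2 - real (card {j \<in> S. a i \<bullet> a j = - 1}))"
  proof (rule sum.cong[OF refl])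
    fix i assume i: "i \<in> S"
    have "a i \<bullet> ?u = a i \<bullet> a i + (\<Sum>j\<in>S - {i}. a i \<bullet> a j)"
      using fin i by (simp add: inner_sum_right sum.remove inner_add_right)
    also have "(\<Sum>j\<in>S - {i}. a i \<bullet> a j) = (\<Sum>j\<in>S - {i}. if a i \<bullet> a j = - 1 then - 1 else 0)"
      using simple_inner[of i] i assms(1) by (intro sum.cong) auto
    also have "\<dots> = - real (card {j \<in> S - {i}. a i \<bullet> a j = - 1})"
      using fin by (simp add: sum.If_cases Int_def)
    also have "{j \<in> S - {i}. a i \<bullet> a j = - 1} = {j \<in> S. a i \<bullet> a j = - 1}"
      using a_norm2[of i] i assms(1) by auto
    finally show "a i \<bullet> ?u = 2 - real (card {j \<in> S. a i \<bullet> a j = - 1})"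
      using a_norm2[of i] i assms(1) by auto
  qed
  also have "\<dots> = real (2 * card S) - real (\<Sum>i\<in>S. card {j \<in> S. a i \<bullet> a j = - 1})"
    by (simp add: sum_subtractf)
  finally show ?thesis by linarith
qed

text \<open>\<open>g i j\<close> transports a value along the edge from \<open>i\<close> to
  \<open>j\<close>, and \<open>g j i\<close> undoes it. On a forest such transports never conflict:
  the degree count yields a vertex with at most one neighbour, which is removed and assigned last.
  It is used with negation for a two-colouring and with integer shifts for a height
  function.\<close>

lemma forest_extension:
  assumes g: "\<And>i j y. i \<in> I \<Longrightarrow> j \<in> I \<Longrightarrow> a i \<bullet> a j = - 1 \<Longrightarrow> g j i (g i j y) = (y::'b)"
    and S: "S \<subseteq> I"
  shows "\<exists>h. \<forall>i\<in>S. \<forall>j\<in>S. a i \<bullet> a j = - 1 \<longrightarrow> h j = g i j (h i)"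
  using finite_subset[OF S finite_I] S
proof (induction S rule: finite_psubset_induct)
  case (psubset S)
  show ?case
  proof (cases "S = {}")
    case False
    have "\<exists>i\<in>S. card {j \<in> S. a i \<bullet> a j = - 1} \<le> 1"
    proof (rule ccontr)
      assume "\<not> ?thesis"
      then have "\<And>i. i \<in> S \<Longrightarrow> 2 \<le> card {j \<in> S. a i \<bullet> a j = - 1}" by force
      then have "(\<Sum>i\<in>S. 2) \<le> (\<Sum>i\<in>S. card {j \<in> S. a i \<bullet> a j = - 1})" by (rule sum_mono)
      then show False using forest_degree[OF psubset.prems False] by simp
    qed
    then obtain k where k: "k \<in> S" "card {j \<in> S. a k \<bullet> a j = - 1} \<le> 1" by blast
    then have kI: "k \<in> I" using psubset.prems by auto
    obtain h where h: "\<forall>i\<in>S - {k}. \<forall>j\<in>S - {k}. a i \<bullet> a j = - 1 \<longrightarrow> h j = g i j (h i)"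
      using psubset.IH[of "S - {k}"] psubset.prems k by blast
    have kk: "a k \<bullet> a k \<noteq> - 1" by (simp add: a_norm2 kI)
    show ?thesis
    proof (cases "{j \<in> S. a k \<bullet> a j = - 1} = {}")
      case True
      then have "i \<noteq> k \<and> j \<noteq> k" if "i \<in> S" "j \<in> S" "a i \<bullet> a j = - 1" for i j
        using that by (auto simp: inner_commute)
      then show ?thesis using h by blast
    next
      case False
      then have "card {j \<in> S. a k \<bullet> a j = - 1} = 1"
        using k psubset.hyps card_gt_0_iff[of "{j \<in> S. a k \<bullet> a j = - 1}"] by simp
      then obtain l where l: "{j \<in> S. a k \<bullet> a j = - 1} = {l}" by (auto simp: card_1_singleton_iff)
      then have l': "l \<in> S" "a k \<bullet> a l = - 1" "l \<noteq> k"
        and only: "\<And>j. j \<in> S \<Longrightarrow> a k \<bullet> a j = - 1 \<Longrightarrow> j = l" using kk by blast+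
      have lI: "l \<in> I" using l' psubset.prems by auto
      have lk: "a l \<bullet> a k = - 1" using l' by (simp add: inner_commute)
      let ?h = "h(k := g l k (h l))"
      have "?h j = g i j (?h i)" if ij: "i \<in> S" "j \<in> S" "a i \<bullet> a j = - 1" for i j
      proof -
        consider "i = k" "j = l" | "i = l" "j = k" | "i \<noteq> k" "j \<noteq> k"
          using ij only kk by (metis inner_commute)
        then show ?thesis
        proof cases
          case 1
          then show ?thesis using l' g[OF lI kI lk] by simp
        qed (use l' h ij in auto)
      qed
      then show ?thesis by blast
    qed
  qed simp
qed

lemma bipartite: "\<exists>col :: 'i \<Rightarrow> bool. \<forall>i\<in>I. \<forall>j\<in>I. a i \<bullet> a j = - 1 \<longrightarrow> col j = (\<not> col i)"
  using forest_extension[of "\<lambda>i j. Not" I] by simp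

end

section \<open>Transitivity on simple systems\<close>

context simple_base
begin

text \<open>The nonnegative integral coordinates of \<open>y\<close> and \<open>z\<close> add up to
  a unit vector, so one of the two roots would be zero.\<close>

lemma simple_indecomposable:
  assumes "i \<in> I" "y \<in> R" "z \<in> R" "pos y" "pos z" "a i = y + z"
  shows False
proof -
  have sum: "y \<bullet> \<omega> k + z \<bullet> \<omega> k = (if k = i then 1 else 0)" if "k \<in> I" for k
    using that assms(1,6) dual[of i k] by (auto simp: inner_add_left)
  have nonneg: "y \<bullet> \<omega> k \<ge> 0" "z \<bullet> \<omega> k \<ge> 0" if "k \<in> I" for k
    using that assms(4,5) by (auto simp: pos_def)
  obtain m n where mn: "y \<bullet> \<omega> i = of_int m" "z \<bullet> \<omega> i = of_int n"
    using root_coord_Ints[OF assms(2,1)] root_coord_Ints[OF assms(3,1)] by (auto elim!: Ints_cases)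
  have "real_of_int (m + n) = 1" using sum[OF assms(1)] mn by simp
  then have "m + n = 1" by linarith
  moreover have "m \<ge> 0" "n \<ge> 0" using nonneg[OF assms(1)] mn by auto
  ultimately have "m = 0 \<or> n = 0" by linarith
  moreover have "y \<bullet> \<omega> k = 0" "z \<bullet> \<omega> k = 0" if "k \<in> I" "k \<noteq> i" for k
    using sum[OF that(1)] nonneg[OF that(1)] that(2) by auto
  ultimately have "y = 0 \<or> z = 0"
    using coord_eqI[of y 0] coord_eqI[of z 0] mn by (metis inner_zero_left of_int_0)
  then show False using assms zero_notin by auto
qed

text \<open>A positive root other than \<open>a i\<close> has a positive coordinate off
  \<open>i\<close>, and the reflection in \<open>a i\<close> leaves that coordinate alone.\<close>

lemma pos_reflection:
  assumes "x \<in> R" "pos x" "i \<in> I" "x \<noteq> a i"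
  shows "pos (reflection (a i) x)"
proof -
  obtain k where k: "k \<in> I" "k \<noteq> i" "x \<bullet> \<omega> k \<noteq> 0"
    using root_on_orthogonal_simples[OF assms(1,2), of "{i}"] assms(3,4) by auto
  then have "x \<bullet> \<omega> k > 0" using assms(2) by (force simp: pos_def)
  moreover have "reflection (a i) x \<bullet> \<omega> k = x \<bullet> \<omega> k"
    using k assms(3) by (simp add: reflection_root a_in_R inner_diff_left dual)
  ultimately show ?thesis
    using posI[OF weyl_in_R[OF weyl_reflection[OF a_in_R[OF assms(3)]] assms(1)] k(1)] by simp
qed

lemma simple_base_weyl:
  assumes w: "w \<in> weyl_group R"
  shows "simple_base R I (w \<circ> a)"
proof unfold_locales
  show "inj_on (w \<circ> a) I"
    using inj_a weyl_inj[OF w] by (metis comp_inj_on inj_on_subset subset_UNIV)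
  have lin: "linear w" and inj: "inj w" using weyl_linear[OF w] weyl_inj[OF w] by auto
  have surj: "surj w"
    using orthogonal_transformation_surj[OF weyl_orthogonal[OF w]] .
  show "simple_system R ((w \<circ> a) ` I)"
    unfolding simple_system_def
  proof (intro conjI ballI)
    show "(w \<circ> a) ` I \<subseteq> R" using a_in_R weyl_in_R[OF w] by auto
    show "independent ((w \<circ> a) ` I)"
      unfolding image_comp[symmetric]
      by (rule linear_independent_injective_image[OF lin independent_a]) (use inj in \<open>simp add: span_a\<close>)
    show "span ((w \<circ> a) ` I) = UNIV"
      unfolding image_comp[symmetric] linear_span_image[OF lin] span_a using surj by simp
    fix \<beta> assume "\<beta> \<in> R"
    then obtain \<gamma> where \<gamma>: "\<gamma> \<in> R" "\<beta> = w \<gamma>" using weyl_R[OF w] by blast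
    obtain c :: "'a \<Rightarrow> int" where c: "\<gamma> = (\<Sum>\<alpha>\<in>a ` I. of_int (c \<alpha>) *\<^sub>R \<alpha>)"
      "(\<forall>\<alpha>\<in>a ` I. c \<alpha> \<ge> 0) \<or> (\<forall>\<alpha>\<in>a ` I. c \<alpha> \<le> 0)"
      using simple \<gamma>(1) unfolding simple_system_def by blast
    have "\<beta> = (\<Sum>\<alpha>\<in>a ` I. of_int (c \<alpha>) *\<^sub>R w \<alpha>)"
      unfolding \<gamma>(2) c(1) by (simp add: linear_sum[OF lin] linear_scale[OF lin])
    also have "\<dots> = (\<Sum>\<alpha>\<in>w ` a ` I. of_int (c (inv w \<alpha>)) *\<^sub>R \<alpha>)"
      using inj by (subst sum.reindex) (auto intro: inj_on_subset)
    finally show "\<exists>c :: 'a \<Rightarrow> int. \<beta> = (\<Sum>\<alpha>\<in>(w \<circ> a) ` I. of_int (c \<alpha>) *\<^sub>R \<alpha>) \<and>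
        ((\<forall>\<alpha>\<in>(w \<circ> a) ` I. c \<alpha> \<ge> 0) \<or> (\<forall>\<alpha>\<in>(w \<circ> a) ` I. c \<alpha> \<le> 0))"
      using c(2) inj by (intro exI[of _ "c \<circ> inv w"]) (auto simp: image_comp)
  qed
qed

lemma dual_weyl:
  assumes w: "w \<in> weyl_group R" and k: "k \<in> I"
  shows "dual_basis I (w \<circ> a) k = w (\<omega> k)"
proof -
  interpret W: simple_base R I "w \<circ> a" by (rule simple_base_weyl[OF w])
  show ?thesis
  proof (rule W.inner_a_eqI)
    fix i assume i: "i \<in> I"
    have "(w \<circ> a) i \<bullet> w (\<omega> k) = a i \<bullet> \<omega> k" by (simp add: weyl_inner[OF w])
    then show "(w \<circ> a) i \<bullet> dual_basis I (w \<circ> a) k = (w \<circ> a) i \<bullet> w (\<omega> k)"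
      using W.dual[OF i k] dual[OF i k] by simp
  qed
qed

end

text \<open>Simple roots are the indecomposable positive roots. A simple \<open>x\<close> has
  positive inner product with some \<open>b j\<close>; were they different, \<open>x - b j\<close>
  would be a root, and according to its sign either \<open>x\<close> or \<open>b j\<close> would
  decompose.\<close>

lemma simple_systems_subsetI:
  assumes "simple_base R I a" "simple_base R J b"
    and sub: "\<And>x. x \<in> R \<Longrightarrow> simple_base.pos I a x \<Longrightarrow> simple_base.pos J b x"
  shows "a ` I \<subseteq> b ` J"
proof
  interpret A: simple_base R I a by fact
  interpret B: simple_base R J b by fact
  \<comment> \<open>Exactly one of \<open>x\<close> and \<open>- x\<close> is positive, so the
    inclusion of positive roots is an equality.\<close>
  have sub': "A.pos x" if "x \<in> R" "B.pos x" for x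
    using that sub[OF A.uminus_root[OF that(1)]] A.root_not_pos[OF that(1)] B.root_not_pos[OF that(1)] by blast
  fix x assume "x \<in> a ` I"
  then obtain i where i: "i \<in> I" "x = a i" by blast
  have x: "x \<in> R" "A.pos x" "B.pos x" using i A.a_in_R A.pos_a sub by auto
  have "0 < x \<bullet> x" using A.norm2[OF x(1)] by simp
  also have "x \<bullet> x = x \<bullet> (\<Sum>j\<in>J. (x \<bullet> B.\<omega> j) *\<^sub>R b j)" by (simp only: B.expand)
  also have "\<dots> = (\<Sum>j\<in>J. (x \<bullet> B.\<omega> j) * (x \<bullet> b j))" by (simp add: inner_sum_right)
  finally obtain j where j: "j \<in> J" "(x \<bullet> B.\<omega> j) * (x \<bullet> b j) > 0"
    by (meson not_le sum_nonpos)
  then have xb: "x \<bullet> b j > 0" using x(3) by (auto simp: B.pos_def zero_less_mult_iff dest: bspec)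
  have bj: "b j \<in> R" "B.pos (b j)" "A.pos (b j)" using j B.a_in_R B.pos_a sub' by auto
  have "x = b j"
  proof (rule ccontr)
    assume ne: "x \<noteq> b j"
    have "x \<noteq> - b j" using xb A.norm2[OF bj(1)] by auto
    then have 1: "x \<bullet> b j = 1" using A.root_inner[OF bj(1) x(1) ne] xb by auto
    have d: "x - b j \<in> R"
      using A.weyl_in_R[OF weyl_reflection[OF bj(1)] x(1)] 1 by (simp add: A.reflection_root bj)
    show False
    proof (cases "A.pos (x - b j)")
      case True
      show False by (rule A.simple_indecomposable[OF i(1) d bj(1) True bj(3)]) (simp add: i)
    next
      case False
      then have "A.pos (b j - x)" using A.root_not_pos[OF d] by simp
      moreover have "b j - x \<in> R" using A.uminus_root[OF d] by simp
      ultimately show False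
        using B.simple_indecomposable[OF j(1) _ x(1) _ x(3), of "b j - x"] sub by simp
    qed
  qed
  then show "x \<in> b ` J" using j by blast
qed

text \<open>The induction counts the roots on which the two positivities disagree. If a simple
  \<open>a i\<close> is negative for \<open>b\<close>, reflecting in it changes positivity only for
  \<open>a i\<close> and its negative, and so lowers the count.\<close>

lemma weyl_transitive:
  assumes "simple_base R I a" "simple_base R J b"
  shows "\<exists>w\<in>weyl_group R. w ` a ` I = b ` J"
  using assms
proof (induction "card {x \<in> R. simple_base.pos I a x \<and> \<not> simple_base.pos J b x}"
    arbitrary: a rule: less_induct)
  case less
  interpret A: simple_base R I a by fact
  interpret B: simple_base R J b by fact
  show ?case
  proof (cases "\<forall>i\<in>I. B.pos (a i)")
    case True
    have sub: "B.pos x" if "x \<in> R" "A.pos x" for x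
      unfolding B.pos_def
    proof
      fix j assume j: "j \<in> J"
      have "x \<bullet> B.\<omega> j = (\<Sum>i\<in>I. (x \<bullet> A.\<omega> i) *\<^sub>R a i) \<bullet> B.\<omega> j" by (simp only: A.expand)
      also have "\<dots> = (\<Sum>i\<in>I. (x \<bullet> A.\<omega> i) * (a i \<bullet> B.\<omega> j))" by (simp add: inner_sum_left)
      also have "\<dots> \<ge> 0"
        using True that(2) j by (intro sum_nonneg mult_nonneg_nonneg) (simp_all add: A.pos_def B.pos_def)
      finally show "x \<bullet> B.\<omega> j \<ge> 0" .
    qed
    have "A.pos x" if "x \<in> R" "B.pos x" for x
      using that sub[OF A.uminus_root[OF that(1)]] A.root_not_pos[OF that(1)] B.root_not_pos[OF that(1)] by blast
    then have "a ` I = b ` J"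
      using simple_systems_subsetI[OF less.prems] simple_systems_subsetI[OF less.prems(2,1)] sub by blast
    then show ?thesis using weyl_group.one[of R] by (intro bexI[of _ id]) auto
  next
    case False
    then obtain i where i: "i \<in> I" "\<not> B.pos (a i)" by blast
    let ?s = "reflection (a i)"
    have s: "?s \<in> weyl_group R" by (rule weyl_reflection[OF A.a_in_R[OF i(1)]])
    interpret S: simple_base R I "?s \<circ> a" by (rule A.simple_base_weyl[OF s])
    have Spos: "S.pos x \<longleftrightarrow> A.pos (?s x)" for x
    proof -
      have "x \<bullet> ?s v = ?s x \<bullet> v" for v
        using weyl_inner[OF s, of x "?s v"] weyl_inner[OF s, of "?s x" v] by simp
      then show ?thesis by (simp add: S.pos_def A.pos_def A.dual_weyl[OF s])
    qed
    have sa: "?s (a i) = - a i" by (simp add: A.reflection_root A.a_in_R A.a_norm2 i scaleR_2)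
    have neg: "\<not> A.pos (- a i)" "B.pos (- a i)"
      using A.root_not_pos[OF A.a_in_R[OF i(1)]] B.root_not_pos[OF A.a_in_R[OF i(1)]] A.pos_a i by auto
    let ?N = "{x \<in> R. A.pos x \<and> \<not> B.pos x}"
    have "{x \<in> R. S.pos x \<and> \<not> B.pos x} \<subseteq> ?N - {a i}"
    proof
      fix x assume "x \<in> {x \<in> R. S.pos x \<and> \<not> B.pos x}"
      then have x: "x \<in> R" "A.pos (?s x)" "\<not> B.pos x" by (auto simp: Spos)
      have "x \<noteq> a i" using x(2) sa neg by auto
      moreover have "?s x \<noteq> a i" using sa x(3) neg(2) by (metis reflection_involution)
      then have "A.pos x"
        using A.pos_reflection[OF A.weyl_in_R[OF s x(1)] x(2) i(1)] by simp
      ultimately show "x \<in> ?N - {a i}" using x by blast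
    qed
    moreover have "a i \<in> ?N" using A.a_in_R A.pos_a i by blast
    ultimately have "card {x \<in> R. S.pos x \<and> \<not> B.pos x} < card ?N"
      using A.finite_R by (intro psubset_card_mono) (simp, blast)
    from less.hyps[OF this S.simple_base_axioms less.prems(2)]
    obtain w where w: "w \<in> weyl_group R" "w ` (?s \<circ> a) ` I = b ` J" by blast
    then show ?thesis
      using weyl_comp[OF w(1) s] by (intro bexI[of _ "w \<circ> ?s"]) (auto simp: image_comp)
  qed
qed

section \<open>Relative order of the letters of a word\<close>

lemma precedes_append:
  "precedes (xs @ ys) i j \<longleftrightarrow> precedes xs i j \<or> precedes ys i j \<or> i \<in> set xs \<and> j \<in> set ys"
proof
  assume "precedes (xs @ ys) i j"
  then obtain p q where "p < q" "q < length xs + length ys" "(xs @ ys) ! p = i" "(xs @ ys) ! q = j"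
    unfolding precedes_def by auto
  then show "precedes xs i j \<or> precedes ys i j \<or> i \<in> set xs \<and> j \<in> set ys"
  proof (cases "q < length xs"; cases "p < length xs")
    assume "\<not> q < length xs" "\<not> p < length xs"
    then have "precedes ys i j"
      using \<open>p < q\<close> \<open>q < _\<close> \<open>_ = i\<close> \<open>_ = j\<close> unfolding precedes_def
      by (intro exI[of _ "p - length xs"] exI[of _ "q - length xs"]) (auto simp: nth_append)
    then show ?thesis by simp
  next
    assume "q < length xs" "p < length xs"
    then have "precedes xs i j"
      using \<open>p < q\<close> \<open>_ = i\<close> \<open>_ = j\<close> unfolding precedes_def by (auto simp: nth_append)
    then show ?thesis by simp
  next
    assume "\<not> q < length xs" "p < length xs"
    then show ?thesis
      using \<open>q < _\<close> \<open>_ = i\<close> \<open>_ = j\<close> by (auto simp: nth_append)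
  qed (use \<open>p < q\<close> in simp)
next
  assume "precedes xs i j \<or> precedes ys i j \<or> i \<in> set xs \<and> j \<in> set ys"
  then consider "precedes xs i j" | "precedes ys i j" | "i \<in> set xs" "j \<in> set ys" by blast
  then show "precedes (xs @ ys) i j"
  proof cases
    case 1
    then obtain p q where "p < q" "q < length xs" "xs ! p = i" "xs ! q = j"
      unfolding precedes_def by auto
    then show ?thesis unfolding precedes_def
      by (intro exI[of _ p] exI[of _ q]) (auto simp: nth_append)
  next
    case 2
    then obtain p q where "p < q" "q < length ys" "ys ! p = i" "ys ! q = j"
      unfolding precedes_def by auto
    then show ?thesis unfolding precedes_def
      by (intro exI[of _ "length xs + p"] exI[of _ "length xs + q"]) (auto simp: nth_append)
  next
    case 3
    then obtain p q where "p < length xs" "xs ! p = i" "q < length ys" "ys ! q = j"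
      by (auto simp: in_set_conv_nth)
    then show ?thesis unfolding precedes_def
      by (intro exI[of _ p] exI[of _ "length xs + q"]) (auto simp: nth_append)
  qed
qed

lemma precedes_Cons: "precedes (x # xs) i j \<longleftrightarrow> i = x \<and> j \<in> set xs \<or> precedes xs i j"
  using precedes_append[of "[x]" xs i j] by (auto simp: precedes_def)

lemma precedes_Nil [simp]: "\<not> precedes [] i j"
  by (simp add: precedes_def)

lemma precedes_in_set: "precedes xs i j \<Longrightarrow> i \<in> set xs \<and> j \<in> set xs"
  by (auto simp: precedes_def)

lemma precedes_trans:
  "distinct xs \<Longrightarrow> precedes xs i j \<Longrightarrow> precedes xs j k \<Longrightarrow> precedes xs i k"
  by (induction xs) (auto simp: precedes_Cons dest: precedes_in_set)

lemma precedes_irrefl: "distinct xs \<Longrightarrow> \<not> precedes xs i i"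
  by (induction xs) (auto simp: precedes_Cons)

lemma precedes_total: "i \<in> set xs \<Longrightarrow> j \<in> set xs \<Longrightarrow> i \<noteq> j \<Longrightarrow> precedes xs i j \<or> precedes xs j i"
  by (induction xs) (auto simp: precedes_Cons)

section \<open>Coxeter words and source flips\<close>

text \<open>Counterpart of \<open>expression_for\<close> for an arbitrary family, so that it applies
  to reflected systems.\<close>

definition cox_word :: "'i set \<Rightarrow> ('i \<Rightarrow> 'a::euclidean_space) \<Rightarrow> ('a \<Rightarrow> 'a) \<Rightarrow> 'i list \<Rightarrow> bool" where
  "cox_word I a C is \<longleftrightarrow> distinct is \<and> set is = I \<and> C = refl_prod (map a is)"

text \<open>No word for \<open>C\<close> occurs here, so whatever is computed from a word through
  \<open>bvec\<close> is independent of that word.\<close>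

definition bvec :: "'i set \<Rightarrow> ('i \<Rightarrow> 'a::euclidean_space) \<Rightarrow> ('a \<Rightarrow> 'a) \<Rightarrow> 'i \<Rightarrow> 'a" where
  "bvec I a C k = dual_basis I a k - C (dual_basis I a k)"

text \<open>For pairwise orthogonal simple roots this is the product of their reflections, written
  without an order of the factors.\<close>

definition sum_refl :: "('i \<Rightarrow> 'a::euclidean_space) \<Rightarrow> 'i set \<Rightarrow> 'a \<Rightarrow> 'a" where
  "sum_refl a J v = v - (\<Sum>j\<in>J. (v \<bullet> a j) *\<^sub>R a j)"

context simple_base
begin

lemma cox_word_weyl: "cox_word I a C is \<Longrightarrow> C \<in> weyl_group R"
  using a_in_R by (auto simp: cox_word_def intro!: weyl_refl_prod)

text \<open>The weight \<open>\<omega> k\<close> is fixed by every simple reflection but the one in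
  \<open>a k\<close>, which subtracts \<open>a k\<close>; the letters before \<open>k\<close> then
  act on \<open>a k\<close> only.\<close>

lemma bvec_word:
  assumes "cox_word I a C (p @ k # q)"
  shows "bvec I a C k = refl_prod (map a p) (a k)"
proof -
  have dist: "distinct (p @ k # q)" and I: "I = set (p @ k # q)"
    and C: "C = refl_prod (map a (p @ k # q))"
    using assms by (auto simp: cox_word_def)
  have k: "k \<in> I" using I by simp
  have fixed_vec: "refl_prod (map a xs) (\<omega> k) = \<omega> k" if "set xs \<subseteq> I - {k}" for xs
  proof (rule refl_prod_fixes)
    fix i assume "i \<in> set xs"
    then have "i \<in> I" "i \<noteq> k" using that by auto
    then show "\<omega> k \<bullet> a i = 0" using dual[OF _ k] by (simp add: inner_commute)
  qed
  have "C (\<omega> k) = refl_prod (map a p) (\<omega> k - a k)"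
  proof -
    have "refl_prod (map a q) (\<omega> k) = \<omega> k" using fixed_vec[of q] I dist by auto
    moreover have "reflection (a k) (\<omega> k) = \<omega> k - a k"
      using dual[OF k k] by (simp add: reflection_root a_in_R[OF k] inner_commute)
    ultimately show ?thesis by (simp add: C)
  qed
  also have "\<dots> = \<omega> k - refl_prod (map a p) (a k)"
    using fixed_vec[of p] I dist
    by (auto simp: linear_diff[OF orthogonal_transformation_linear[OF orthogonal_transformation_refl_prod]])
  finally show ?thesis by (simp add: bvec_def)
qed

text \<open>Telescoping: appending the letter \<open>k\<close> to a prefix subtracts
  \<open>v \<bullet> a k\<close> times the prefix image of \<open>a k\<close>, which is
  \<open>bvec\<close> at \<open>k\<close>.\<close>

lemma refl_prod_prefix:
  assumes "cox_word I a C (p @ q)"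
  shows "refl_prod (map a p) v = v - (\<Sum>j\<in>set p. (v \<bullet> a j) *\<^sub>R bvec I a C j)"
  using assms
proof (induction p arbitrary: q rule: rev_induct)
  case (snoc k p)
  have k: "k \<in> I" "k \<notin> set p" using snoc.prems by (auto simp: cox_word_def)
  have lin: "linear (refl_prod (map a p))"
    by (rule orthogonal_transformation_linear[OF orthogonal_transformation_refl_prod])
  have "refl_prod (map a (p @ [k])) v = refl_prod (map a p) v - (v \<bullet> a k) *\<^sub>R refl_prod (map a p) (a k)"
    by (simp add: reflection_root a_in_R k linear_diff[OF lin] linear_scale[OF lin])
  then show ?case
    using snoc.IH[of "k # q"] snoc.prems bvec_word[of C p k q] k
    by (simp del: map_append refl_prod_append)
qed simp

text \<open>The prefix formula at \<open>v = a k\<close>: only earlier neighbours of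
  \<open>k\<close> contribute, and their inner product -1 turns the minus sign into a plus.\<close>

lemma bvec_recursion:
  assumes "cox_word I a C is" "k \<in> I"
  shows "bvec I a C k = a k + (\<Sum>j\<in>{j \<in> I. a j \<bullet> a k = - 1 \<and> precedes is j k}. bvec I a C j)"
proof -
  obtain p q where pq: "is = p @ k # q"
    using assms split_list[of k "is"] by (auto simp: cox_word_def)
  have dist: "distinct (p @ k # q)" and I: "I = set (p @ k # q)"
    using assms pq by (auto simp: cox_word_def)
  have before: "precedes is j k \<longleftrightarrow> j \<in> set p" for j
    using dist precedes_irrefl[OF dist] unfolding pq
    by (auto simp: precedes_append precedes_Cons dest: precedes_in_set)
  have "bvec I a C k = a k - (\<Sum>j\<in>set p. (a k \<bullet> a j) *\<^sub>R bvec I a C j)"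
    using bvec_word[of C p k q] refl_prod_prefix[of C p "k # q"] assms pq by simp
  also have "(\<Sum>j\<in>set p. (a k \<bullet> a j) *\<^sub>R bvec I a C j)
      = (\<Sum>j\<in>set p. if a j \<bullet> a k = - 1 then - bvec I a C j else 0)"
  proof (rule sum.cong[OF refl])
    fix j assume "j \<in> set p"
    then have "j \<in> I" "k \<in> I" "j \<noteq> k" using I dist by auto
    from simple_inner[OF this]
    show "(a k \<bullet> a j) *\<^sub>R bvec I a C j = (if a j \<bullet> a k = - 1 then - bvec I a C j else 0)"
      by (auto simp: inner_commute)
  qed
  also have "\<dots> = (\<Sum>j\<in>{j \<in> set p. a j \<bullet> a k = - 1}. - bvec I a C j)"
    by (rule sum.inter_filter[symmetric]) simp
  also have "{j \<in> set p. a j \<bullet> a k = - 1} = {j \<in> I. a j \<bullet> a k = - 1 \<and> precedes is j k}"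
    unfolding before using I by auto
  finally show ?thesis by (simp add: sum_negf)
qed

text \<open>Two distinct arrows into \<open>k\<close> with a common ancestor would close a cycle: take the last common
  ancestor \<open>x\<close>, then every vertex on a path from \<open>x\<close> to \<open>k\<close> has two neighbours among these vertices.\<close>

lemma sources_disjoint:
  fixes E :: "('i \<times> 'i) set"
  assumes E: "\<And>i j. (i, j) \<in> E \<Longrightarrow> i \<in> I \<and> j \<in> I \<and> a i \<bullet> a j = - 1"
    and acyc: "acyclic E" and jk: "(j, k) \<in> E" "(j', k) \<in> E" "j \<noteq> j'"
  shows "{i \<in> I. (i, j) \<in> E\<^sup>*} \<inter> {i \<in> I. (i, j') \<in> E\<^sup>*} = {}"
proof (rule ccontr)
  assume ne: "\<not> ?thesis"
  let ?Q = "{i \<in> I. (i, j) \<in> E\<^sup>*} \<inter> {i \<in> I. (i, j') \<in> E\<^sup>*}"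
  have "finite E" by (rule finite_subset[of _ "I \<times> I"]) (use E finite_I in auto)
  then have wf: "wf (E\<inverse>)" using acyc by (rule finite_acyclic_wf_converse)
  obtain x where x: "x \<in> ?Q" "\<And>y. (y, x) \<in> E\<inverse> \<Longrightarrow> y \<notin> ?Q"
    using ne wfE_min[OF wf, of _ ?Q] by blast
  have xQ: "x \<in> I" "(x, j) \<in> E\<^sup>*" "(x, j') \<in> E\<^sup>*" using x(1) by auto
  have max: False if "(x, y) \<in> E" "(y, j) \<in> E\<^sup>*" "(y, j') \<in> E\<^sup>*" for y
    using x(2)[of y] that E by blast
  have nocycle: False if "(u, v) \<in> E\<^sup>*" "(v, u) \<in> E" for u v
    using that acyc by (meson acyclic_def rtrancl_into_trancl2)
  have nocycle': False if "(u, v) \<in> E\<^sup>*" "(v, w) \<in> E" "(w, u) \<in> E\<^sup>*" for u v w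
    using nocycle[of w v] that by (meson rtrancl_trans)
  define S where "S = {v \<in> I. (x, v) \<in> E\<^sup>* \<and> (v, k) \<in> E\<^sup>*}"
  have in_I: "j \<in> I" "j' \<in> I" "k \<in> I" using jk E by auto
  have jS: "j \<in> S" "j' \<in> S" using xQ in_I jk unfolding S_def by auto
  have kS: "k \<in> S" unfolding S_def using in_I xQ jk(1) by (auto intro: rtrancl_into_rtrancl)
  have nbr: "\<exists>y z. y \<noteq> z \<and> y \<in> S \<and> z \<in> S \<and> a v \<bullet> a y = - 1 \<and> a v \<bullet> a z = - 1" if v: "v \<in> S" for v
  proof -
    have succ: "\<exists>y\<in>S. (u, y) \<in> E \<and> (y, w) \<in> E\<^sup>*"
      if uw: "u \<in> S" "(u, w) \<in> E\<^sup>*" "u \<noteq> w" "(w, k) \<in> E\<^sup>*" for u w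
    proof -
      obtain y where y: "(u, y) \<in> E" "(y, w) \<in> E\<^sup>*" using uw(2,3) by (metis converse_rtranclE)
      have "y \<in> S" using y uw E unfolding S_def
        by (auto intro: rtrancl_into_rtrancl rtrancl_trans)
      then show ?thesis using y by blast
    qed
    have vI: "v \<in> I" using v by (simp add: S_def)
    consider "v = k" | "v = x" "v \<noteq> k" | "v \<noteq> x" "v \<noteq> k" by blast
    then show ?thesis
    proof cases
      case 1
      have "a v \<bullet> a j = - 1" "a v \<bullet> a j' = - 1" using 1 E[OF jk(1)] E[OF jk(2)] by (simp_all add: inner_commute)
      then show ?thesis using jk(3) jS by blast
    next
      case 2
      have xS: "x \<in> S" using v 2 by simp
      \<comment> \<open>If \<open>x\<close> is itself \<open>j\<close>, the arrow from
        \<open>j\<close> to \<open>k\<close> serves as the first step of this branch; likewise for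
        \<open>j'\<close>.\<close>
      have j: "\<exists>y\<in>S. (x, y) \<in> E \<and> (x \<noteq> j \<longrightarrow> (y, j) \<in> E\<^sup>*) \<and> (x = j \<longrightarrow> y = k)"
        using succ[OF xS xQ(2)] jk(1) kS by (cases "x = j") auto
      have j': "\<exists>y\<in>S. (x, y) \<in> E \<and> (x \<noteq> j' \<longrightarrow> (y, j') \<in> E\<^sup>*) \<and> (x = j' \<longrightarrow> y = k)"
        using succ[OF xS xQ(3)] jk(2) kS by (cases "x = j'") auto
      obtain y where y: "y \<in> S" "(x, y) \<in> E" "x \<noteq> j \<Longrightarrow> (y, j) \<in> E\<^sup>*" "x = j \<Longrightarrow> y = k" using j by blast
      obtain z where z: "z \<in> S" "(x, z) \<in> E" "x \<noteq> j' \<Longrightarrow> (z, j') \<in> E\<^sup>*" "x = j' \<Longrightarrow> z = k" using j' by blast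
      have "y \<noteq> z"
      proof
        assume yz: "y = z"
        consider "x \<noteq> j" "x \<noteq> j'" | "x = j" "x \<noteq> j'" | "x = j'" "x \<noteq> j" using jk(3) by blast
        then show False
        proof cases
          case 1 then show False using max y z yz by blast
        next
          case 2 then show False using nocycle[of k j'] jk(2) y z yz by blast
        next
          case 3 then show False using nocycle[of k j] jk(1) y z yz by blast
        qed
      qed
      then show ?thesis using y z E[OF y(2)] E[OF z(2)] 2(1) by auto
    next
      case 3
      have "(v, k) \<in> E\<^sup>*" "(x, v) \<in> E\<^sup>*" using v by (auto simp: S_def)
      then obtain y where y: "y \<in> S" "(v, y) \<in> E"
        using succ[OF v, of k] 3 by blast
      obtain z where z: "(x, z) \<in> E\<^sup>*" "(z, v) \<in> E"
        using \<open>(x, v) \<in> E\<^sup>*\<close> 3 by (metis rtranclE)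
      have zS: "z \<in> S" using z E \<open>(v, k) \<in> E\<^sup>*\<close> unfolding S_def
        by (auto intro: converse_rtrancl_into_rtrancl)
      have "y \<noteq> z" using nocycle[of z v] nocycle[of v z] y(2) z(2) by blast
      then show ?thesis using y zS E[OF y(2)] E[OF z(2)] by (metis inner_commute)
    qed
  qed
  have "2 \<le> card {y \<in> S. a v \<bullet> a y = - 1}" if v: "v \<in> S" for v
  proof -
    obtain y z where yz: "y \<noteq> z" "y \<in> S" "z \<in> S" "a v \<bullet> a y = - 1" "a v \<bullet> a z = - 1"
      using nbr[OF v] by blast
    have "finite {y \<in> S. a v \<bullet> a y = - 1}"
      by (rule finite_subset[OF _ finite_I]) (auto simp: S_def)
    then have "card {y, z} \<le> card {y \<in> S. a v \<bullet> a y = - 1}"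
      using yz by (intro card_mono) auto
    then show ?thesis using yz(1) by simp
  qed
  then have "(\<Sum>v\<in>S. 2) \<le> (\<Sum>v\<in>S. card {y \<in> S. a v \<bullet> a y = - 1})" by (rule sum_mono)
  moreover have "S \<subseteq> I" "S \<noteq> {}" using kS by (auto simp: S_def)
  ultimately show False using forest_degree[of S] by simp
qed

definition word_order :: "'i list \<Rightarrow> ('i \<times> 'i) set" where
  "word_order is = {(i, j). i \<in> I \<and> j \<in> I \<and> a i \<bullet> a j = - 1 \<and> precedes is i j}"

lemma word_order_acyclic:
  assumes "distinct is"
  shows "acyclic (word_order is)"
proof -
  have "precedes is x y" if "(x, y) \<in> (word_order is)\<^sup>+" for x y
    using that by (induction rule: trancl.induct) (auto simp: word_order_def intro: precedes_trans[OF assms])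
  then show ?thesis using precedes_irrefl[OF assms] by (auto simp: acyclic_def)
qed

text \<open>The recursion is solved by induction along the arrows: the ancestors of \<open>k\<close>
  are \<open>k\<close> and the ancestors of its predecessors, a disjoint union because the diagram
  is a forest.\<close>

lemma bvec_sum:
  assumes "cox_word I a C is" "k \<in> I"
  shows "bvec I a C k = (\<Sum>j\<in>{j \<in> I. (j, k) \<in> (word_order is)\<^sup>*}. a j)"
proof -
  let ?E = "word_order is"
  have E: "\<And>i j. (i, j) \<in> ?E \<Longrightarrow> i \<in> I \<and> j \<in> I \<and> a i \<bullet> a j = - 1" by (auto simp: word_order_def)
  have acyc: "acyclic ?E" using assms word_order_acyclic by (auto simp: cox_word_def)
  have "finite ?E" by (rule finite_subset[of _ "I \<times> I"]) (use E finite_I in auto)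
  then have "wf ?E" using acyc by (rule finite_acyclic_wf)
  then show ?thesis using assms(2)
  proof (induction k)
    case (less k)
    let ?D = "\<lambda>k. {j \<in> I. (j, k) \<in> ?E\<^sup>*}"
    let ?P = "{j. (j, k) \<in> ?E}"
    have finP: "finite ?P" by (rule finite_subset[OF _ finite_I]) (use E in auto)
    have "?P = {j \<in> I. a j \<bullet> a k = - 1 \<and> precedes is j k}"
      using less.prems by (auto simp: word_order_def)
    then have "bvec I a C k = a k + (\<Sum>j\<in>?P. bvec I a C j)"
      using bvec_recursion[OF assms(1) less.prems] by simp
    also have "(\<Sum>j\<in>?P. bvec I a C j) = (\<Sum>j\<in>?P. \<Sum>i\<in>?D j. a i)"
      using less.IH E by (intro sum.cong) auto
    also have "\<dots> = (\<Sum>i\<in>(\<Union>j\<in>?P. ?D j). a i)"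
    proof (rule sum.UNION_disjoint[symmetric])
      show "\<forall>i\<in>?P. \<forall>j\<in>?P. i \<noteq> j \<longrightarrow> ?D i \<inter> ?D j = {}"
        using sources_disjoint[OF E acyc] by blast
    qed (use finP finite_I in auto)
    also have "a k + \<dots> = (\<Sum>i\<in>insert k (\<Union>j\<in>?P. ?D j). a i)"
    proof -
      have "k \<notin> (\<Union>j\<in>?P. ?D j)"
        using acyc by (auto simp: acyclic_def dest: rtrancl_into_trancl1)
      then show ?thesis using finP finite_I by simp
    qed
    also have "insert k (\<Union>j\<in>?P. ?D j) = ?D k"
      using less.prems by (auto intro: rtrancl_into_rtrancl elim: rtranclE)
    finally show ?case .
  qed
qed

lemma bvec_coord:
  assumes "cox_word I a C is" "k \<in> I" "i \<in> I"
  shows "bvec I a C k \<bullet> \<omega> i = (if (i, k) \<in> (word_order is)\<^sup>* then 1 else 0)"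
proof -
  have "bvec I a C k = (\<Sum>j\<in>I. (if (j, k) \<in> (word_order is)\<^sup>* then 1 else 0) *\<^sub>R a j)"
    unfolding bvec_sum[OF assms(1,2)]
    by (rule sum.mono_neutral_cong_left) (use finite_I in auto)
  then show ?thesis using assms(3) by (simp only: sum_dual)
qed

text \<open>Reachability is a coordinate of \<open>bvec\<close> and so does not depend on the word;
  in an acyclic orientation it determines the direction of each edge.\<close>

lemma word_order_unique:
  assumes "cox_word I a C is" "cox_word I a C js"
  shows "word_order is \<subseteq> word_order js"
proof
  fix e assume e: "e \<in> word_order is"
  obtain i j where ij: "e = (i, j)" "i \<in> I" "j \<in> I" "a i \<bullet> a j = - 1"
    using e by (auto simp: word_order_def)
  have ne: "i \<noteq> j" using ij a_norm2 by auto
  have "(i, j) \<in> (word_order js)\<^sup>*"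
    using bvec_coord[OF assms(1) ij(3,2)] bvec_coord[OF assms(2) ij(3,2)] e ij(1) by (auto split: if_splits)
  moreover have "(j, i) \<notin> word_order js"
    using calculation word_order_acyclic[of js] assms(2)
    by (auto simp: cox_word_def acyclic_def dest: rtrancl_into_trancl2)
  moreover have "precedes js i j \<or> precedes js j i"
    using precedes_total[of i js j] ij ne assms(2) by (auto simp: cox_word_def)
  ultimately show "e \<in> word_order js" using ij by (auto simp: word_order_def inner_commute)
qed

text \<open>The hypothesis \<open>orth\<close> says that \<open>i\<close> is a source, so its
  reflection can be moved to the front of the word. Passing to the reflected system conjugates the
  letters and moves it to the end. Among the weights only \<open>\<omega> i\<close> changes.\<close>

lemma flip:
  assumes word: "cox_word I a C (p @ i # q)" and orth: "\<forall>j\<in>set p. a j \<bullet> a i = 0"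
  defines "b \<equiv> reflection (a i) \<circ> a"
  shows "cox_word I b C (p @ q @ [i])"
    and "k \<in> I \<Longrightarrow> bvec I b C k = (if k = i then C (bvec I a C i) else bvec I a C k)"
proof -
  let ?s = "reflection (a i)"
  have i: "i \<in> I" using word by (auto simp: cox_word_def)
  have C: "C = refl_prod (map a (p @ i # q))" using word by (auto simp: cox_word_def)
  have Cw: "C \<in> weyl_group R" by (rule cox_word_weyl[OF word])
  have s: "?s \<in> weyl_group R" by (rule weyl_reflection[OF a_in_R[OF i]])
  note image = refl_prod_orthogonal_image[OF orthogonal_transformation_reflection[of "a i"], of a, folded b_def]
  have "map b p = map a p" using orth by (simp add: b_def reflection_def)
  then have comm: "refl_prod (map a p) (?s v) = ?s (refl_prod (map a p) v)" for v
    using image[of p v] by (simp only:)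
  have "refl_prod (map b (p @ q @ [i])) (?s (?s v)) = C v" for v
    unfolding image by (simp add: C comm)
  then have "C = refl_prod (map b (p @ q @ [i]))" by auto
  then show "cox_word I b C (p @ q @ [i])" using word by (auto simp: cox_word_def)
  have "bvec I a C i = a i"
    unfolding bvec_word[OF word] by (rule refl_prod_fixes) (use orth in \<open>simp add: inner_commute\<close>)
  then have Cai: "C (a i) = C (bvec I a C i)" "bvec I a C i = a i" by simp_all
  assume k: "k \<in> I"
  have dual: "dual_basis I b k = \<omega> k - (if k = i then a i else 0)"
    using dual_weyl[OF s k] k i dual[OF i k]
    by (simp add: b_def reflection_root a_in_R inner_commute)
  show "bvec I b C k = (if k = i then C (bvec I a C i) else bvec I a C k)"
  proof (cases "k = i")
    case True
    \<comment> \<open>For a source, \<open>a i\<close> is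
      \<open>\<omega> i - C (\<omega> i)\<close>, so the new weight is the image of the old one
      under \<open>C\<close>.\<close>
    have "\<omega> i - a i = C (\<omega> i)" using Cai(2) by (simp add: bvec_def algebra_simps)
    then show ?thesis
      using True unfolding bvec_def dual by (simp add: linear_diff[OF weyl_linear[OF Cw]])
  qed (simp add: bvec_def dual)
qed

end

text \<open>\<open>h\<close> is a height function of the orientation. A vertex of minimal height is a source, and
  flipping it raises its height by 2; this ends with all heights in \<open>{M, M + 1}\<close>.\<close>

lemma reach_bipartite_word:
  assumes "simple_base R I a" "cox_word I a C is"
    and "\<And>i j. precedes is i j \<Longrightarrow> a i \<bullet> a j = - 1 \<Longrightarrow> h j = h i + (1::int)"
    and "\<And>i. i \<in> I \<Longrightarrow> even (h i) \<longleftrightarrow> col i"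
    and "even M" "\<And>i. i \<in> I \<Longrightarrow> h i \<le> M + 1"
  shows "\<exists>w\<in>weyl_group R. \<exists>js. cox_word I (w \<circ> a) C js \<and>
      (\<forall>i j. precedes js i j \<longrightarrow> a i \<bullet> a j = - 1 \<longrightarrow> col i) \<and>
      (\<forall>k\<in>I. \<exists>n. bvec I (w \<circ> a) C k = (C ^^ n) (bvec I a C k))"
  using assms(1-4,6)
proof (induction "\<Sum>i\<in>I. nat (M + 1 - h i)" arbitrary: a h "is" rule: less_induct)
  case less
  interpret simple_base R I a by fact
  have dist: "distinct is" and set: "set is = I" using less.prems(2) by (auto simp: cox_word_def)
  show ?case
  proof (cases "\<forall>i\<in>I. M \<le> h i")
    case True
    \<comment> \<open>With all heights in \<open>{M, M + 1}\<close> an arrow from \<open>i\<close>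
      to \<open>j\<close> leaves only \<open>h i = M\<close>, which is even.\<close>
    have "col i" if "precedes is i j" "a i \<bullet> a j = - 1" for i j
    proof -
      have "i \<in> I" "j \<in> I" using precedes_in_set[OF that(1)] set by auto
      then have "h i = M" using True less.prems(3)[OF that] less.prems(5)[of j] by fastforce
      then show ?thesis using less.prems(4)[OF \<open>i \<in> I\<close>] assms(5) by simp
    qed
    moreover have "\<exists>n. bvec I (id \<circ> a) C k = (C ^^ n) (bvec I a C k)" for k
      by (rule exI[of _ 0]) simp
    ultimately show ?thesis using less.prems(2) weyl_group.one[of R]
      by (intro bexI[of _ id] exI[of _ "is"]) auto
  next
    case False
    then have ne: "I \<noteq> {}" by auto
    obtain i where i: "i \<in> I" "\<And>j. j \<in> I \<Longrightarrow> h i \<le> h j"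
      using ex_is_arg_min_if_finite[OF finite_I ne, of h] by (auto simp: is_arg_min_linorder)
    have hi: "h i < M" using False i(2) by (meson le_less_trans not_le)
    obtain p q where pq: "is = p @ i # q" using split_list[of i "is"] i(1) set by auto
    have orth: "\<forall>j\<in>set p. a j \<bullet> a i = 0"
    proof (intro ballI, rule ccontr)
      fix j assume that: "j \<in> set p"
      assume "a j \<bullet> a i \<noteq> 0"
      moreover have j: "j \<in> I" "j \<noteq> i" using that set dist pq by auto
      ultimately have "a j \<bullet> a i = - 1" using simple_inner i(1) by blast
      moreover have "precedes is j i" using that unfolding pq by (auto simp: precedes_append)
      ultimately show False using less.prems(3)[of j i] i(2)[OF j(1)] by simp
    qed
    define b where "b = reflection (a i) \<circ> a"
    have word: "cox_word I a C (p @ i # q)" using less.prems(2) pq by simp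
    note flip = flip[OF word orth, folded b_def]
    have s: "reflection (a i) \<in> weyl_group R" by (rule weyl_reflection[OF a_in_R[OF i(1)]])
    have inner_b: "b j \<bullet> b k = a j \<bullet> a k" for j k by (simp add: b_def weyl_inner[OF s])
    \<comment> \<open>A rise of 2 keeps the parity, hence the colour, and turns the difference +1
      along each edge at \<open>i\<close> into -1, matching the reversal of the arrows
      there.\<close>
    define h' where "h' = h(i := h i + 2)"
    have "\<exists>w\<in>weyl_group R. \<exists>js. cox_word I (w \<circ> b) C js \<and>
      (\<forall>i j. precedes js i j \<longrightarrow> b i \<bullet> b j = - 1 \<longrightarrow> col i) \<and>
      (\<forall>k\<in>I. \<exists>n. bvec I (w \<circ> b) C k = (C ^^ n) (bvec I b C k))"
    proof (rule less.hyps)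
      have "(\<Sum>j\<in>I - {i}. nat (M + 1 - h' j)) = (\<Sum>j\<in>I - {i}. nat (M + 1 - h j))"
        by (rule sum.cong) (auto simp: h'_def)
      moreover have "nat (M + 1 - h' i) < nat (M + 1 - h i)" using hi by (simp add: h'_def)
      ultimately show "(\<Sum>j\<in>I. nat (M + 1 - h' j)) < (\<Sum>j\<in>I. nat (M + 1 - h j))"
        using finite_I i(1) by (simp add: sum.remove[of I i])
      show "simple_base R I b" unfolding b_def by (rule simple_base_weyl[OF s])
      show "cox_word I b C (p @ q @ [i])" by (rule flip(1))
      show "even (h' j) \<longleftrightarrow> col j" if "j \<in> I" for j
        using that less.prems(4) by (auto simp: h'_def)
      show "h' j \<le> M + 1" if "j \<in> I" for j
        using that less.prems(5) hi by (auto simp: h'_def)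
      show "h' k = h' j + 1" if jk: "precedes (p @ q @ [i]) j k" "b j \<bullet> b k = - 1" for j k
      proof -
        have "i \<notin> set p" "i \<notin> set q" using dist pq by auto
        then consider "j \<noteq> i" "k \<noteq> i" "precedes is j k" | "k = i" "j \<in> set p" | "k = i" "j \<in> set q"
          using jk(1) unfolding pq
          by (auto simp: precedes_append precedes_Cons dest: precedes_in_set)
        then show ?thesis
        proof cases
          case 1
          then show ?thesis using less.prems(3)[of j k] jk(2) inner_b by (auto simp: h'_def)
        next
          case 2
          then show ?thesis using orth jk(2) inner_b by simp
        next
          case 3
          then have "precedes is i j" "j \<noteq> i"
            using \<open>i \<notin> set q\<close> unfolding pq by (auto simp: precedes_append precedes_Cons)
          then show ?thesis
            using less.prems(3)[of i j] jk(2) inner_b 3 by (auto simp: h'_def inner_commute)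
        qed
      qed
    qed
    then obtain w js where w: "w \<in> weyl_group R" "cox_word I (w \<circ> b) C js"
      "\<And>i j. precedes js i j \<Longrightarrow> b i \<bullet> b j = - 1 \<Longrightarrow> col i"
      "\<And>k. k \<in> I \<Longrightarrow> \<exists>n. bvec I (w \<circ> b) C k = (C ^^ n) (bvec I b C k)" by blast
    have wb: "(w \<circ> reflection (a i)) \<circ> a = w \<circ> b" by (simp add: b_def comp_assoc)
    have "\<exists>n. bvec I (w \<circ> b) C k = (C ^^ n) (bvec I a C k)" if k: "k \<in> I" for k
    proof (cases "k = i")
      case True
      then obtain n where "bvec I (w \<circ> b) C k = (C ^^ n) (C (bvec I a C k))"
        using w(4)[OF k] flip(2)[OF k] by auto
      then have "bvec I (w \<circ> b) C k = (C ^^ Suc n) (bvec I a C k)"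
        by (metis comp_apply funpow_Suc_right)
      then show ?thesis by blast
    next
      case False
      then show ?thesis using w(4)[OF k] flip(2)[OF k] by simp
    qed
    then show ?thesis
      using w weyl_comp[OF w(1) s] unfolding wb[symmetric] inner_b by blast
  qed
qed

section \<open>Coxeter words with all letters of one colour first\<close>

context simple_base
begin

lemma refl_prod_sum_refl:
  assumes "distinct xs" "set xs \<subseteq> I" "\<And>i j. i \<in> set xs \<Longrightarrow> j \<in> set xs \<Longrightarrow> i \<noteq> j \<Longrightarrow> a i \<bullet> a j = 0"
  shows "refl_prod (map a xs) v = sum_refl a (set xs) v"
  using assms
proof (induction xs)
  case (Cons x xs)
  have orth: "(\<Sum>j\<in>set xs. (v \<bullet> a j) *\<^sub>R a j) \<bullet> a x = 0"
    unfolding inner_sum_left using Cons.prems by (intro sum.neutral) auto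
  have "refl_prod (map a xs) v = sum_refl a (set xs) v" using Cons by simp
  then show ?case
    using Cons.prems orth by (simp add: sum_refl_def reflection_root a_in_R inner_diff_left)
qed (simp add: sum_refl_def)

text \<open>Of two non-orthogonal letters the earlier has colour \<open>col\<close>, so a letter of
  the other colour commutes with all \<open>col\<close> letters after it and can be moved behind
  them.\<close>

lemma refl_prod_split:
  assumes "distinct xs" "set xs \<subseteq> I"
    and "\<And>i j. precedes xs i j \<Longrightarrow> a i \<bullet> a j \<noteq> 0 \<Longrightarrow> col i \<and> \<not> col j"
  shows "refl_prod (map a xs) v
    = refl_prod (map a (filter col xs)) (refl_prod (map a (filter (\<lambda>i. \<not> col i) xs)) v)"
  using assms
proof (induction xs)
  case (Cons x xs)
  have IH: "refl_prod (map a xs) v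
    = refl_prod (map a (filter col xs)) (refl_prod (map a (filter (\<lambda>i. \<not> col i) xs)) v)"
  proof (rule Cons.IH)
    show "col i \<and> \<not> col j" if "precedes xs i j" "a i \<bullet> a j \<noteq> 0" for i j
      using Cons.prems(3)[of i j] that by (simp add: precedes_Cons)
  qed (use Cons.prems in simp_all)
  show ?case
  proof (cases "col x")
    case False
    have orth: "a j \<bullet> a x = 0" if "j \<in> set (filter col xs)" for j
      using Cons.prems(3)[of x j] that False by (auto simp: precedes_Cons inner_commute)
    have "map (reflection (a x) \<circ> a) (filter col xs) = map a (filter col xs)"
      using orth by (simp add: reflection_def)
    then have "refl_prod (map a (filter col xs)) (reflection (a x) u)
        = reflection (a x) (refl_prod (map a (filter col xs)) u)" for u
      using refl_prod_orthogonal_image[OF orthogonal_transformation_reflection[of "a x"],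
          of a "filter col xs" u] by (simp only:)
    then show ?thesis using IH False by simp
  qed (use IH in simp)
qed simp

lemma bipartite_word:
  assumes word: "cox_word I a C js" and col: "\<And>i j. i \<in> I \<Longrightarrow> j \<in> I \<Longrightarrow> a i \<bullet> a j = - 1 \<Longrightarrow> col j = (\<not> col i)"
    and sorted: "\<And>i j. precedes js i j \<Longrightarrow> a i \<bullet> a j = - 1 \<Longrightarrow> col i"
  shows "C v = sum_refl a {i \<in> I. col i} (sum_refl a {i \<in> I. \<not> col i} v)"
proof -
  have dist: "distinct js" and set: "set js = I" using word by (auto simp: cox_word_def)
  have orth: "a i \<bullet> a j = 0" if "i \<in> I" "j \<in> I" "i \<noteq> j" "col i = col j" for i j
    using simple_inner[OF that(1-3)] col[OF that(1,2)] that(4) by auto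
  have "C v = refl_prod (map a js) v" using word by (simp add: cox_word_def)
  also have "\<dots> = refl_prod (map a (filter col js)) (refl_prod (map a (filter (\<lambda>i. \<not> col i) js)) v)"
  proof (rule refl_prod_split[OF dist])
    fix i j assume ij: "precedes js i j" "a i \<bullet> a j \<noteq> 0"
    have "i \<in> I" "j \<in> I" "i \<noteq> j"
      using precedes_in_set[OF ij(1)] precedes_irrefl[OF dist] ij(1) set by auto
    then have "a i \<bullet> a j = - 1" using simple_inner ij(2) by blast
    then show "col i \<and> \<not> col j" using sorted[OF ij(1)] col[of i j] \<open>i \<in> I\<close> \<open>j \<in> I\<close> by blast
  qed (simp add: set)
  also have "\<dots> = sum_refl a {i \<in> I. col i} (sum_refl a {i \<in> I. \<not> col i} v)"
  proof -
    have "refl_prod (map a (filter P js)) u = sum_refl a {i \<in> I. P i} u"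
      if P: "\<And>i j. P i \<Longrightarrow> P j \<Longrightarrow> col i = col j" for P u
    proof -
      have "set (filter P js) = {i \<in> I. P i}" using set by auto
      moreover have "refl_prod (map a (filter P js)) u = sum_refl a (set (filter P js)) u"
        by (rule refl_prod_sum_refl) (use dist set orth P in auto)
      ultimately show ?thesis by simp
    qed
    from this[of col] this[of "\<lambda>i. \<not> col i"] show ?thesis by simp
  qed
  finally show ?thesis .
qed

end

section \<open>The Perron vector of the diagram\<close>

context simple_base
begin

definition nb :: "'i \<Rightarrow> 'i set" where "nb i = {j \<in> I. a i \<bullet> a j = - 1}"

lemma nb_I: "nb i \<subseteq> I" and finite_nb: "finite (nb i)"
  using finite_I by (auto simp: nb_def)

lemma inner_a:
  assumes "k \<in> I"
  shows "v \<bullet> a k = 2 * (v \<bullet> \<omega> k) - (\<Sum>j\<in>nb k. v \<bullet> \<omega> j)"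
proof -
  have "v \<bullet> a k = (\<Sum>j\<in>I. (v \<bullet> \<omega> j) *\<^sub>R a j) \<bullet> a k" by (simp only: expand)
  also have "\<dots> = (\<Sum>j\<in>I. (if j = k then 2 * (v \<bullet> \<omega> k) else 0) - (if j \<in> nb k then v \<bullet> \<omega> j else 0))"
    unfolding inner_sum_left
  proof (rule sum.cong[OF refl])
    fix j assume "j \<in> I"
    then show "(v \<bullet> \<omega> j) *\<^sub>R a j \<bullet> a k
        = (if j = k then 2 * (v \<bullet> \<omega> k) else 0) - (if j \<in> nb k then v \<bullet> \<omega> j else 0)"
      using simple_inner[of j k] a_norm2[of k] assms by (auto simp: nb_def inner_commute)
  qed
  also have "\<dots> = 2 * (v \<bullet> \<omega> k) - (\<Sum>j\<in>nb k. v \<bullet> \<omega> j)"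
    using assms finite_I nb_I[of k] by (simp add: sum_subtractf sum.If_cases Int_absorb1)
  finally show ?thesis .
qed

lemma linear_sum_refl: "linear (sum_refl a J)"
  by (rule linearI)
    (simp_all add: sum_refl_def inner_add_left scaleR_add_left sum.distrib scaleR_sum_right scaleR_diff_right)

text \<open>A proper closed \<open>J\<close> would split the roots into those supported on
  \<open>J\<close> and those supported on its complement, two nonempty orthogonal classes.\<close>

lemma connected_diagram:
  assumes irr: "irreducible_roots R" and J: "J \<subseteq> I" "J \<noteq> {}" and closed: "\<And>i. i \<in> J \<Longrightarrow> nb i \<subseteq> J"
  shows "J = I"
proof (rule ccontr)
  assume ne: "J \<noteq> I"
  obtain j where j: "j \<in> J" "j \<in> I" using J by blast
  obtain i where i: "i \<in> I" "i \<notin> J" using J ne by blast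
  have orth: "a i \<bullet> a j = 0" if "i \<in> J" "j \<in> I - J" for i j
    using simple_inner[of i j] closed[OF that(1)] that J by (auto simp: nb_def)
  define P where "P K x \<longleftrightarrow> (\<forall>i\<in>K. x \<bullet> \<omega> i = 0)" for K x
  define proj where "proj K x = (\<Sum>i\<in>K. (x \<bullet> \<omega> i) *\<^sub>R a i)" for K x
  have split: "x = proj J x + proj (I - J) x" for x
    using expand[of x] sum.subset_diff[OF J(1) finite_I, of "\<lambda>i. (x \<bullet> \<omega> i) *\<^sub>R a i"]
    by (simp add: proj_def add.commute)
  have proj_orth: "proj J x \<bullet> proj (I - J) y = 0" for x y
    unfolding proj_def inner_sum_left inner_sum_right using orth by (intro sum.neutral ballI) simp
  have proj_zero: "proj K x = 0" if "P K x" for K x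
    using that by (auto simp: P_def proj_def)
  have zero_proj: "P K x" if "proj K x = 0" "K \<subseteq> I" for K x
    unfolding P_def
  proof
    fix k assume k: "k \<in> K"
    have "proj K x = (\<Sum>i\<in>I. (if i \<in> K then x \<bullet> \<omega> i else 0) *\<^sub>R a i)"
      unfolding proj_def by (rule sum.mono_neutral_cong_left) (use that(2) finite_I in auto)
    then have "proj K x \<bullet> \<omega> k = x \<bullet> \<omega> k"
      using k that(2) sum_dual[of k "\<lambda>i. if i \<in> K then x \<bullet> \<omega> i else 0"] by auto
    then show "x \<bullet> \<omega> k = 0" using that(1) by simp
  qed
  \<comment> \<open>norms in the root lattice are even, so a vector of norm 2 is not a sum of two nonzero
    orthogonal lattice vectors\<close>
  have dichotomy: "P (I - J) x \<or> P J x" if x: "x \<in> R" for x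
  proof -
    obtain m n :: int where mn: "proj J x \<bullet> proj J x = 2 * of_int m"
      "proj (I - J) x \<bullet> proj (I - J) x = 2 * of_int n"
      using even_norm[of J "\<lambda>i. x \<bullet> \<omega> i"] even_norm[of "I - J" "\<lambda>i. x \<bullet> \<omega> i"]
        root_coord_Ints[OF x] J(1) unfolding proj_def by blast
    have "2 = x \<bullet> x" by (simp add: norm2 x)
    also have "\<dots> = (proj J x + proj (I - J) x) \<bullet> (proj J x + proj (I - J) x)" using split[of x] by simp
    also have "\<dots> = 2 * of_int m + 2 * of_int n"
      using proj_orth[of x x] mn by (simp add: inner_add_left inner_add_right inner_commute)
    finally have "real_of_int (m + n) = 1" by simp
    then have "m + n = 1" by linarith
    moreover have "m \<ge> 0" "n \<ge> 0"
      using mn inner_ge_zero[of "proj J x"] inner_ge_zero[of "proj (I - J) x"] by auto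
    ultimately have "m = 0 \<or> n = 0" by linarith
    then have "proj J x = 0 \<or> proj (I - J) x = 0" using mn by auto
    then show ?thesis using zero_proj J(1) by blast
  qed
  let ?A = "{x \<in> R. P (I - J) x}" and ?B = "{x \<in> R. P J x}"
  have 1: "a j \<in> ?A" using j a_in_R dual by (auto simp: P_def)
  have 2: "a i \<in> ?B" using i a_in_R dual J(1) by (auto simp: P_def)
  have 3: "?A \<inter> ?B = {}"
  proof -
    have "x = 0" if "P (I - J) x" "P J x" for x
      using split[of x] proj_zero[OF that(1)] proj_zero[OF that(2)] by simp
    then show ?thesis using zero_notin by blast
  qed
  have 4: "?A \<union> ?B = R" using dichotomy by auto
  have 5: "x \<bullet> y = 0" if "x \<in> ?A" "y \<in> ?B" for x y
  proof -
    have "x = proj J x" "y = proj (I - J) y" using that split[of x] split[of y] proj_zero by auto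
    then show ?thesis using proj_orth by metis
  qed
  have irr': False if "x \<in> A" "y \<in> B" "A \<inter> B = {}" "A \<union> B = R"
    "\<And>x y. x \<in> A \<Longrightarrow> y \<in> B \<Longrightarrow> x \<bullet> y = 0" for x y A B
  proof -
    have "A \<noteq> {}" "B \<noteq> {}" using that(1,2) by auto
    moreover have "\<forall>x\<in>A. \<forall>y\<in>B. x \<bullet> y = 0" using that(5) by simp
    ultimately have "\<exists>A B. A \<noteq> {} \<and> B \<noteq> {} \<and> A \<inter> B = {} \<and> A \<union> B = R \<and> (\<forall>x\<in>A. \<forall>y\<in>B. x \<bullet> y = 0)"
      using that(3,4) by (intro exI conjI)
    then show False using irr unfolding irreducible_roots_def by (elim conjE notE)
  qed
  show False by (rule irr'[OF 1 2 3 4 5])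
qed

end

locale irreducible_base = simple_base R I a
  for R :: "'a::euclidean_space set" and I :: "'i set" and a :: "'i \<Rightarrow> 'a" +
  assumes irreducible: "irreducible_roots R"
begin

lemma I_nonempty: "I \<noteq> {}"
proof
  assume "I = {}"
  then have "v = 0" for v :: 'a using expand[of v] by simp
  then show False using irreducible zero_notin unfolding irreducible_roots_def by (metis ex_in_conv)
qed

text \<open>A zero entry makes the nonnegative entries at all neighbours vanish, and connectedness
  spreads this to the whole diagram.\<close>

lemma nonneg_eigenvector_zero:
  assumes "\<And>i. i \<in> I \<Longrightarrow> y i \<ge> 0" "\<And>i. i \<in> I \<Longrightarrow> (\<Sum>j\<in>nb i. y j) = l * y i"
    and "k \<in> I" "y k = (0::real)" "i \<in> I"
  shows "y i = 0"
proof -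
  have "{i \<in> I. y i = 0} = I"
  proof (rule connected_diagram[OF irreducible])
    show "nb i \<subseteq> {i \<in> I. y i = 0}" if "i \<in> {i \<in> I. y i = 0}" for i
    proof -
      have "(\<Sum>j\<in>nb i. y j) = 0" using that assms(2) by simp
      then have "\<forall>j\<in>nb i. y j = 0"
        using assms(1) nb_I[of i] by (subst (asm) sum_nonneg_eq_0_iff) (auto simp: finite_nb)
      then show ?thesis using nb_I[of i] by auto
    qed
  qed (use assms in auto)
  then show ?thesis using assms(5) by auto
qed

text \<open>Perron--Frobenius for the adjacency matrix \<open>A\<close> of the Dynkin diagram, by applying Brouwer's
  theorem to the normalised map \<open>1 + A\<close> on the simplex spanned by the simple roots.\<close>

lemma perron_vector:
  obtains x :: "'i \<Rightarrow> real" and l where "\<And>i. i \<in> I \<Longrightarrow> x i > 0"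
    "\<And>i. i \<in> I \<Longrightarrow> (\<Sum>j\<in>nb i. x j) = l * x i" "0 \<le> l" "l < 2"
proof -
  \<comment> \<open>The inner products with the \<open>a i\<close> apply the Cartan matrix
    \<open>2 - A\<close> to the coordinates, so \<open>T\<close> is \<open>1 + A\<close>. The added
    identity keeps the height of \<open>T v\<close> at least 1 on \<open>S\<close>, as the division
    in \<open>f\<close> requires.\<close>
  define T where "T v = 3 *\<^sub>R v - (\<Sum>i\<in>I. (v \<bullet> a i) *\<^sub>R a i)" for v
  define \<rho> where "\<rho> = (\<Sum>i\<in>I. \<omega> i)"
  define f where "f v = (1 / (T v \<bullet> \<rho>)) *\<^sub>R T v" for v
  define S where "S = convex hull (a ` I)"
  have ht: "v \<bullet> \<rho> = (\<Sum>i\<in>I. v \<bullet> \<omega> i)" for v by (simp add: \<rho>_def inner_sum_right)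
  have S: "v \<in> S \<longleftrightarrow> (\<forall>i\<in>I. v \<bullet> \<omega> i \<ge> 0) \<and> v \<bullet> \<rho> = 1" for v
  proof
    assume "v \<in> S"
    then obtain u where u: "\<forall>x\<in>a ` I. 0 \<le> u x" "sum u (a ` I) = 1" "(\<Sum>x\<in>a ` I. u x *\<^sub>R x) = v"
      unfolding S_def convex_hull_finite[OF finite_imageI[OF finite_I]] by blast
    have "v = (\<Sum>i\<in>I. u (a i) *\<^sub>R a i)" using u(3) by (simp add: sum.reindex[OF inj_a])
    then have v: "v \<bullet> \<omega> i = u (a i)" if "i \<in> I" for i using sum_dual[OF that, of "u \<circ> a"] by simp
    have "(\<Sum>i\<in>I. v \<bullet> \<omega> i) = (\<Sum>i\<in>I. u (a i))" using v by (intro sum.cong) auto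
    also have "\<dots> = 1" using u(2) by (simp add: sum.reindex[OF inj_a])
    finally show "(\<forall>i\<in>I. v \<bullet> \<omega> i \<ge> 0) \<and> v \<bullet> \<rho> = 1" using u(1) v by (auto simp: ht)
  next
    assume v: "(\<forall>i\<in>I. v \<bullet> \<omega> i \<ge> 0) \<and> v \<bullet> \<rho> = 1"
    have "(\<Sum>i\<in>I. (v \<bullet> \<omega> i) *\<^sub>R a i) \<in> convex hull (a ` I)"
      using v finite_I by (intro convex_sum) (auto simp: ht hull_inc)
    then show "v \<in> S" by (simp add: S_def expand)
  qed
  have T: "T v \<bullet> \<omega> k = v \<bullet> \<omega> k + (\<Sum>j\<in>nb k. v \<bullet> \<omega> j)" if "k \<in> I" for v k
    using inner_a[OF that, of v] sum_dual[OF that, of "\<lambda>i. v \<bullet> a i"]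
    by (simp add: T_def inner_diff_left)
  have T_pos: "T v \<bullet> \<omega> k \<ge> v \<bullet> \<omega> k" if "v \<in> S" "k \<in> I" for v k
    using that T[of k v] nb_I[of k] by (auto simp: S intro!: sum_nonneg)
  have T_ht: "T v \<bullet> \<rho> \<ge> 1" if "v \<in> S" for v
  proof -
    have "v \<bullet> \<rho> \<le> T v \<bullet> \<rho>" unfolding ht by (rule sum_mono) (rule T_pos[OF that])
    then show ?thesis using that by (simp add: S)
  qed
  obtain v where v: "v \<in> S" "f v = v"
  proof (rule brouwer[of S f])
    show "compact S" unfolding S_def by (rule finite_imp_compact_convex_hull) (simp add: finite_I)
    show "convex S" by (simp add: S_def)
    show "S \<noteq> {}" by (simp add: S_def I_nonempty)
    show "continuous_on S f"
      unfolding f_def using T_ht by (intro continuous_intros) (fastforce simp: T_def intro!: continuous_intros)+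
    show "f \<in> S \<rightarrow> S"
    proof
      fix v assume v: "v \<in> S"
      show "f v \<in> S"
        unfolding S f_def using T_ht[OF v] T_pos[OF v] v
        by (force simp: S intro: order_trans divide_nonneg_nonneg)
    qed
  qed auto
  define l where "l = T v \<bullet> \<rho> - 1"
  have "T v = (l + 1) *\<^sub>R f v" using T_ht[OF v(1)] by (simp add: f_def l_def)
  then have Tv: "T v = (l + 1) *\<^sub>R v" using v(2) by simp
  let ?x = "\<lambda>i. v \<bullet> \<omega> i"
  have eig: "(\<Sum>j\<in>nb i. ?x j) = l * ?x i" if "i \<in> I" for i
    using T[OF that, of v] by (simp add: Tv algebra_simps)
  have nonneg: "?x i \<ge> 0" if "i \<in> I" for i using v(1) that by (simp add: S)
  have xpos: "?x i > 0" if "i \<in> I" for i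
  proof (rule ccontr)
    assume "\<not> ?x i > 0"
    then have "?x i = 0" using nonneg[OF that] by simp
    then have "?x j = 0" if "j \<in> I" for j
      using nonneg_eigenvector_zero[of ?x l i j, OF nonneg eig] \<open>i \<in> I\<close> that by blast
    then show False using v(1) by (simp add: S ht)
  qed
  \<comment> \<open>Positive definiteness bounds the eigenvalue: \<open>v \<bullet> v\<close> is
    \<open>2 - l\<close> times a sum of squares.\<close>
  have "v \<noteq> 0" using v(1) by (auto simp: S)
  then have "0 < v \<bullet> v" by simp
  also have "v \<bullet> v = v \<bullet> (\<Sum>i\<in>I. ?x i *\<^sub>R a i)" by (simp only: expand)
  also have "\<dots> = (\<Sum>i\<in>I. (2 - l) * (?x i)\<^sup>2)"
    unfolding inner_sum_right
  proof (rule sum.cong[OF refl])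
    fix k assume "k \<in> I"
    then have "v \<bullet> a k = (2 - l) * ?x k" using inner_a[of k v] eig[of k] by (simp add: algebra_simps)
    then show "v \<bullet> ?x k *\<^sub>R a k = (2 - l) * (?x k)\<^sup>2" by (simp add: power2_eq_square)
  qed
  also have "\<dots> = (2 - l) * (\<Sum>i\<in>I. (?x i)\<^sup>2)" by (simp add: sum_distrib_left)
  finally have "2 - l > 0" by (meson not_le split_mult_neg_le sum_nonneg zero_le_power2 mult_nonpos_nonneg)
  moreover have "l \<ge> 0" using T_ht[OF v(1)] by (simp add: l_def)
  ultimately show ?thesis using that[of ?x l] xpos eig by auto
qed

text \<open>Subtract the largest multiple of \<open>x\<close> that leaves \<open>z\<close>
  nonnegative; the difference is an eigenvector with a zero entry, at the vertex minimising
  \<open>z i / x i\<close>.\<close>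

lemma perron_simple:
  assumes x: "\<And>i. i \<in> I \<Longrightarrow> x i > (0::real)" "\<And>i. i \<in> I \<Longrightarrow> (\<Sum>j\<in>nb i. x j) = l * x i"
    and z: "\<And>i. i \<in> I \<Longrightarrow> (\<Sum>j\<in>nb i. z j) = l * z i"
  shows "\<exists>c. \<forall>i\<in>I. z i = c * x i"
proof -
  obtain k where k: "k \<in> I" "\<And>j. j \<in> I \<Longrightarrow> z k / x k \<le> z j / x j"
    using ex_is_arg_min_if_finite[OF finite_I I_nonempty, of "\<lambda>i. z i / x i"]
    by (auto simp: is_arg_min_linorder)
  define c where "c = z k / x k"
  let ?y = "\<lambda>i. z i - c * x i"
  have "?y i = 0" if "i \<in> I" for i
  proof (rule nonneg_eigenvector_zero[of ?y l k])
    show "?y i \<ge> 0" if "i \<in> I" for i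
      using k(2)[OF that] x(1)[OF that] by (simp add: c_def pos_le_divide_eq)
    show "(\<Sum>j\<in>nb i. ?y j) = l * ?y i" if "i \<in> I" for i
      using x(2)[OF that] z[OF that]
      by (simp add: sum_subtractf sum_distrib_left[symmetric] algebra_simps)
    show "?y k = 0" using x(1)[OF k(1)] by (simp add: c_def)
  qed (use k that in auto)
  then show ?thesis by (intro exI[of _ c]) auto
qed

end

section \<open>The Coxeter plane\<close>

text \<open>The assumption \<open>rigid\<close> is what equivariance of the labelling says about a
  single simple system.\<close>

locale bipartite_coxeter = irreducible_base R I a
  for R :: "'a::euclidean_space set" and I :: "'i set" and a :: "'i \<Rightarrow> 'a" +
  fixes col :: "'i \<Rightarrow> bool" and C :: "'a \<Rightarrow> 'a"
  assumes col: "i \<in> I \<Longrightarrow> j \<in> I \<Longrightarrow> a i \<bullet> a j = - 1 \<Longrightarrow> col j = (\<not> col i)"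
    and C: "C v = sum_refl a {i \<in> I. col i} (sum_refl a {i \<in> I. \<not> col i} v)"
    and rigid: "w \<in> weyl_group R \<Longrightarrow> w ` a ` I \<subseteq> a ` I \<Longrightarrow> i \<in> I \<Longrightarrow> w (a i) = a i"
begin

abbreviation "sB \<equiv> sum_refl a {i \<in> I. col i}"
abbreviation "sD \<equiv> sum_refl a {i \<in> I. \<not> col i}"

lemma same_colour_orthogonal: "i \<in> I \<Longrightarrow> j \<in> I \<Longrightarrow> i \<noteq> j \<Longrightarrow> col i = col j \<Longrightarrow> a i \<bullet> a j = 0"
  using simple_inner[of i j] col[of i j] by auto

text \<open>Stated for any monochromatic \<open>J\<close>, so that the facts about \<open>sB\<close>
  and \<open>sD\<close> are two instances of one proof.\<close>

lemma colour_class: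
  assumes J: "J \<subseteq> I" "\<forall>i\<in>J. \<forall>j\<in>J. col i = col j"
  shows "sum_refl a J \<in> weyl_group R"
    and "i \<in> J \<Longrightarrow> sum_refl a J (a i) = - a i"
    and "i \<in> I \<Longrightarrow> nb i \<subseteq> J \<Longrightarrow> i \<notin> J \<Longrightarrow> sum_refl a J (a i) = a i + (\<Sum>j\<in>nb i. a j)"
    and "sum_refl a J (sum_refl a J v) = v"
    and "k \<in> I \<Longrightarrow> k \<notin> J \<Longrightarrow> sum_refl a J v \<bullet> \<omega> k = v \<bullet> \<omega> k"
    and "k \<in> I \<Longrightarrow> sum_refl a J (\<omega> k) = \<omega> k - (if k \<in> J then a k else 0)"
proof -
  have fin: "finite J" using J(1) finite_I finite_subset by blast
  then obtain xs where xs: "set xs = J" "distinct xs" using finite_distinct_list by blast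
  have orth: "a i \<bullet> a j = 0" if "i \<in> J" "j \<in> J" "i \<noteq> j" for i j
    using same_colour_orthogonal[of i j] J that by blast
  have "refl_prod (map a xs) = sum_refl a J"
    using refl_prod_sum_refl[OF xs(2)] xs(1) J(1) orth by auto
  then show W: "sum_refl a J \<in> weyl_group R"
    using weyl_refl_prod[of "map a xs" R] xs(1) J(1) a_in_R by fastforce
  show neg: "sum_refl a J (a i) = - a i" if "i \<in> J" for i
  proof -
    have "(\<Sum>j\<in>J. (a i \<bullet> a j) *\<^sub>R a j) = (\<Sum>j\<in>J. if j = i then 2 *\<^sub>R a i else 0)"
      using orth[OF that] a_norm2[of i] that J(1) by (intro sum.cong) auto
    then show ?thesis using that fin by (simp add: sum_refl_def scaleR_2)
  qed
  show "sum_refl a J (a i) = a i + (\<Sum>j\<in>nb i. a j)" if "i \<in> I" "nb i \<subseteq> J" "i \<notin> J"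
  proof -
    have "(\<Sum>j\<in>J. (a i \<bullet> a j) *\<^sub>R a j) = (\<Sum>j\<in>J. if j \<in> nb i then - a j else 0)"
    proof (rule sum.cong[OF refl])
      fix j assume "j \<in> J"
      then have "j \<in> I" "i \<noteq> j" using that J(1) by auto
      then show "(a i \<bullet> a j) *\<^sub>R a j = (if j \<in> nb i then - a j else 0)"
        using simple_inner[OF that(1), of j] by (auto simp: nb_def)
    qed
    also have "\<dots> = (\<Sum>j\<in>nb i. - a j)" using fin that(2) by (simp add: sum.If_cases Int_absorb1)
    finally show ?thesis by (simp add: sum_refl_def sum_negf)
  qed
  show "sum_refl a J (sum_refl a J v) = v"
  proof -
    have lin: "linear (sum_refl a J)" by (rule linear_sum_refl)
    have "sum_refl a J (sum_refl a J v)
        = sum_refl a J v - (\<Sum>j\<in>J. (v \<bullet> a j) *\<^sub>R sum_refl a J (a j))"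
      by (subst (2) sum_refl_def) (simp add: linear_diff[OF lin] linear_sum[OF lin] linear_scale[OF lin])
    also have "(\<Sum>j\<in>J. (v \<bullet> a j) *\<^sub>R sum_refl a J (a j)) = - (\<Sum>j\<in>J. (v \<bullet> a j) *\<^sub>R a j)"
      by (simp add: neg sum_negf)
    finally show ?thesis by (simp add: sum_refl_def)
  qed
  show "sum_refl a J v \<bullet> \<omega> k = v \<bullet> \<omega> k" if "k \<in> I" "k \<notin> J"
  proof -
    have "(\<Sum>j\<in>J. (v \<bullet> a j) *\<^sub>R a j) \<bullet> \<omega> k = 0"
      unfolding inner_sum_left
    proof (rule sum.neutral, rule ballI)
      fix j assume "j \<in> J"
      then have "j \<in> I" "j \<noteq> k" using that J(1) by auto
      then show "(v \<bullet> a j) *\<^sub>R a j \<bullet> \<omega> k = 0" using dual[OF _ that(1)] by simp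
    qed
    then show ?thesis by (simp add: sum_refl_def inner_diff_left)
  qed
  show "sum_refl a J (\<omega> k) = \<omega> k - (if k \<in> J then a k else 0)" if "k \<in> I"
  proof -
    have "(\<Sum>j\<in>J. (\<omega> k \<bullet> a j) *\<^sub>R a j) = (\<Sum>j\<in>J. if j = k then a k else 0)"
      using that J(1) dual[of _ k] by (intro sum.cong) (auto simp: inner_commute)
    then show ?thesis using fin by (auto simp: sum_refl_def)
  qed
qed

lemma black_class: "{i \<in> I. col i} \<subseteq> I" "\<forall>i\<in>{i \<in> I. col i}. \<forall>j\<in>{i \<in> I. col i}. col i = col j"
  and white_class: "{i \<in> I. \<not> col i} \<subseteq> I" "\<forall>i\<in>{i \<in> I. \<not> col i}. \<forall>j\<in>{i \<in> I. \<not> col i}. col i = col j"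
  by auto

lemmas sB = colour_class[OF black_class] and sD = colour_class[OF white_class]

lemma nb_colour: "i \<in> I \<Longrightarrow> j \<in> nb i \<Longrightarrow> col j = (\<not> col i)"
  using col[of i j] by (auto simp: nb_def)

lemma nb_sub: "i \<in> I \<Longrightarrow> \<not> col i \<Longrightarrow> nb i \<subseteq> {i \<in> I. col i}"
    "i \<in> I \<Longrightarrow> col i \<Longrightarrow> nb i \<subseteq> {i \<in> I. \<not> col i}"
  using nb_colour nb_I by blast+

lemma sB_a: "i \<in> I \<Longrightarrow> sB (a i) = (if col i then - a i else a i + (\<Sum>j\<in>nb i. a j))"
  using sB(2,3)[of i] nb_sub[of i] by auto

lemma sD_a: "i \<in> I \<Longrightarrow> sD (a i) = (if col i then a i + (\<Sum>j\<in>nb i. a j) else - a i)"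
  using sD(2,3)[of i] nb_sub[of i] by auto

lemma sB_sB: "sB (sB v) = v" and sD_sD: "sD (sD v) = v"
  using sB(4) sD(4) by auto

lemma sB_weyl: "sB \<in> weyl_group R" and sD_weyl: "sD \<in> weyl_group R"
  using sB(1) sD(1) by auto

lemma C_comp: "C = sB \<circ> sD"
  using C by auto

lemma C_weyl: "C \<in> weyl_group R"
  unfolding C_comp using weyl_comp sB_weyl sD_weyl by blast

text \<open>Each weight is fixed by the factor of \<open>C\<close> that belongs to the other
  colour.\<close>

lemma bvec_bipartite: "k \<in> I \<Longrightarrow> bvec I a C k = (if col k then a k else sB (a k))"
  using sB(6)[of k] sD(6)[of k] linear_diff[OF linear_sum_refl, of "{i \<in> I. col i}" "\<omega> k" "a k"]
  by (cases "col k") (simp_all add: bvec_def C)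

end

text \<open>The linear map \<open>p\<close> is the projection to the Coxeter plane, identified with the complex
  numbers so that \<open>C\<close> acts as the rotation by \<open>2\<phi>\<close>.\<close>

locale coxeter_plane = bipartite_coxeter R I a col C
  for R :: "'a::euclidean_space set" and I :: "'i set" and a :: "'i \<Rightarrow> 'a" and col C +
  fixes x :: "'i \<Rightarrow> real" and \<phi> :: real
  assumes x_pos: "i \<in> I \<Longrightarrow> x i > 0"
    and x_eig: "i \<in> I \<Longrightarrow> (\<Sum>j\<in>nb i. x j) = 2 * cos \<phi> * x i"
    and phi: "0 < \<phi>" "\<phi> \<le> pi / 2"
begin

definition s :: "'a \<Rightarrow> real" where "s v = (\<Sum>i\<in>{i \<in> I. col i}. (v \<bullet> \<omega> i) * x i)"
definition t :: "'a \<Rightarrow> real" where "t v = (\<Sum>i\<in>{i \<in> I. \<not> col i}. (v \<bullet> \<omega> i) * x i)"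
text \<open>Since \<open>- cis (- \<phi>)\<close> has angle \<pi> - \<phi>, black simple roots go to
  the ray of angle 0 and white ones to the ray of angle \<pi> - \<phi>; positive vectors fill the
  sector between.\<close>

definition p :: "'a \<Rightarrow> complex" where "p v = of_real (s v) - of_real (t v) * cis (- \<phi>)"

lemma linear_p: "linear p"
  by (rule linearI)
    (simp_all add: p_def s_def t_def inner_add_left algebra_simps sum.distrib sum_distrib_left scaleR_conv_of_real)

lemma sin_phi: "sin \<phi> > 0"
  using phi by (intro sin_gt_zero) auto

lemma s_a: "i \<in> I \<Longrightarrow> s (a i) = (if col i then x i else 0)"
  and t_a: "i \<in> I \<Longrightarrow> t (a i) = (if col i then 0 else x i)"
proof -
  assume i: "i \<in> I"
  have *: "(\<Sum>j\<in>J. (a i \<bullet> \<omega> j) * x j) = (if i \<in> J then x i else 0)" if "J \<subseteq> I" for J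
  proof -
    have "(\<Sum>j\<in>J. (a i \<bullet> \<omega> j) * x j) = (\<Sum>j\<in>J. if j = i then x i else 0)"
      using i dual that by (intro sum.cong) auto
    then show ?thesis using finite_subset[OF that finite_I] by simp
  qed
  show "s (a i) = (if col i then x i else 0)" "t (a i) = (if col i then 0 else x i)"
    unfolding s_def t_def using i by (subst *; auto)+
qed

lemma p_a: "i \<in> I \<Longrightarrow> p (a i) = (if col i then of_real (x i) else - of_real (x i) * cis (- \<phi>))"
  by (simp add: p_def s_a t_a)

lemma Im_p: "Im (p v) = t v * sin \<phi>" and Re_p: "Re (p v) = s v - t v * cos \<phi>"
  by (simp_all add: p_def)

lemma two_cos: "complex_of_real (2 * cos \<phi>) = cis \<phi> + cis (- \<phi>)"
  by (simp add: complex_eq_iff)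

lemma p_nb_sum:
  assumes "i \<in> I"
  shows "p (\<Sum>j\<in>nb i. a j)
    = of_real (x i) * (cis \<phi> + cis (- \<phi>)) * (if col i then - cis (- \<phi>) else 1)"
proof -
  have "p (\<Sum>j\<in>nb i. a j) = (\<Sum>j\<in>nb i. p (a j))" by (rule linear_sum[OF linear_p])
  also have "\<dots> = (\<Sum>j\<in>nb i. of_real (x j) * (if col i then - cis (- \<phi>) else 1))"
    using nb_colour[OF assms] nb_I[of i] by (intro sum.cong) (auto simp: p_a)
  also have "\<dots> = of_real (\<Sum>j\<in>nb i. x j) * (if col i then - cis (- \<phi>) else 1)"
    by (simp add: sum_distrib_right)
  also have "\<dots> = of_real (x i) * (cis \<phi> + cis (- \<phi>)) * (if col i then - cis (- \<phi>) else 1)"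
    unfolding two_cos[symmetric] x_eig[OF assms] by simp
  finally show ?thesis .
qed

lemma linear_cnj_p: "linear (\<lambda>v. c * cnj (p v))"
  by (rule linearI)
    (simp_all add: linear_add[OF linear_p] linear_scale[OF linear_p] algebra_simps scaleR_conv_of_real)

text \<open>The map \<open>- cnj\<close> mirrors the plane in the imaginary axis. On a white simple
  root the claim is the eigenvalue equation of \<open>x\<close> with eigenvalue
  \<open>cis \<phi> + cis (- \<phi>)\<close>.\<close>

lemma p_sB: "p (sB v) = - cnj (p v)"
proof -
  have "(p \<circ> sB) v = - 1 * cnj (p v)"
  proof (rule linear_eqI[OF linear_compose[OF linear_sum_refl linear_p] linear_cnj_p])
    fix i assume i: "i \<in> I"
    then show "(p \<circ> sB) (a i) = - 1 * cnj (p (a i))"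
      using p_nb_sum[OF i] p_a[OF i]
      by (simp add: sB_a linear_neg[OF linear_p] linear_add[OF linear_p] cis_cnj algebra_simps)
  qed
  then show ?thesis by simp
qed

lemma p_sD: "p (sD v) = - cis (- 2 * \<phi>) * cnj (p v)"
proof -
  have "(p \<circ> sD) v = - cis (- 2 * \<phi>) * cnj (p v)"
  proof (rule linear_eqI[OF linear_compose[OF linear_sum_refl linear_p] linear_cnj_p])
    fix i assume i: "i \<in> I"
    have e: "cis (- \<phi>) * cis (- \<phi>) = cis (- 2 * \<phi>)" "cis \<phi> * cis (- \<phi>) = 1"
      "cis (- 2 * \<phi>) * cis \<phi> = cis (- \<phi>)" by (simp_all add: cis_mult)
    show "(p \<circ> sD) (a i) = - cis (- 2 * \<phi>) * cnj (p (a i))"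
    proof (cases "col i")
      case True
      then have "(p \<circ> sD) (a i) = of_real (x i) * (1 - (cis \<phi> * cis (- \<phi>) + cis (- \<phi>) * cis (- \<phi>)))"
        using p_nb_sum[OF i] p_a[OF i] i
        by (simp add: sD_a linear_add[OF linear_p] algebra_simps)
      then show ?thesis unfolding e using p_a[OF i] True by simp
    next
      case False
      have "- cis (- 2 * \<phi>) * cnj (p (a i)) = of_real (x i) * (cis (- 2 * \<phi>) * cis \<phi>)"
        using p_a[OF i] False by (simp add: cis_cnj)
      moreover have "(p \<circ> sD) (a i) = of_real (x i) * cis (- \<phi>)"
        using p_a[OF i] False i by (simp add: sD_a linear_neg[OF linear_p])
      ultimately show ?thesis by (simp only: e)
    qed
  qed
  then show ?thesis by simp
qed

lemma p_C: "p (C v) = cis (2 * \<phi>) * p v"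
  by (simp add: C p_sB p_sD cis_cnj)

lemma p_funpow_C: "p ((C ^^ n) v) = cis (2 * \<phi>) ^ n * p v"
  by (induction n) (simp_all add: p_C)

section \<open>Positive roots and their images in the plane\<close>

lemma pos_s_t:
  assumes "pos v"
  shows "s v \<ge> 0" "t v \<ge> 0"
    and "s v = 0 \<Longrightarrow> i \<in> I \<Longrightarrow> col i \<Longrightarrow> v \<bullet> \<omega> i = 0"
    and "t v = 0 \<Longrightarrow> i \<in> I \<Longrightarrow> \<not> col i \<Longrightarrow> v \<bullet> \<omega> i = 0"
proof -
  have nn: "0 \<le> (v \<bullet> \<omega> i) * x i" if "i \<in> I" for i
    using assms that x_pos[OF that] by (simp add: pos_def)
  show "s v \<ge> 0" "t v \<ge> 0" unfolding s_def t_def using nn by (auto intro: sum_nonneg)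
  show "v \<bullet> \<omega> i = 0" if "s v = 0" "i \<in> I" "col i"
  proof -
    have "\<forall>j\<in>{i \<in> I. col i}. (v \<bullet> \<omega> j) * x j = 0"
      using that(1) unfolding s_def by (subst (asm) sum_nonneg_eq_0_iff) (use nn finite_I in auto)
    then show ?thesis using that x_pos[of i] by auto
  qed
  show "v \<bullet> \<omega> i = 0" if "t v = 0" "i \<in> I" "\<not> col i"
  proof -
    have "\<forall>j\<in>{i \<in> I. \<not> col i}. (v \<bullet> \<omega> j) * x j = 0"
      using that(1) unfolding t_def by (subst (asm) sum_nonneg_eq_0_iff) (use nn finite_I in auto)
    then show ?thesis using that x_pos[of i] by auto
  qed
qed

lemma pos_p_zero:
  assumes "pos v" "p v = 0"
  shows "v = 0"
proof -
  have "t v = 0" using Im_p[of v] assms(2) sin_phi by simp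
  moreover have "s v = 0" using Re_p[of v] assms(2) calculation by simp
  ultimately show ?thesis using pos_s_t(3,4)[OF assms(1)] by (intro coord_eqI) auto
qed

lemma p_nonneg:
  assumes "pos v"
  shows "Im (p v) \<ge> 0" "Im (p v) = 0 \<Longrightarrow> Re (p v) \<ge> 0"
  using pos_s_t(1,2)[OF assms] sin_phi by (auto simp: Im_p Re_p)

text \<open>An image on the positive real axis forces positivity and leaves no white coordinate, and
  black simple roots are pairwise orthogonal.\<close>

lemma black_root:
  assumes r: "r \<in> R" and p: "p r = of_real c" "c > 0"
  shows "\<exists>i\<in>I. col i \<and> r = a i"
proof -
  have "pos r"
  proof (rule ccontr)
    assume "\<not> pos r"
    then have "pos (- r)" using root_not_pos[OF r] by simp
    then show False using p_nonneg(2)[of "- r"] p by (simp add: linear_neg[OF linear_p])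
  qed
  moreover have "t r = 0" using Im_p[of r] p sin_phi by simp
  ultimately have "\<exists>i\<in>{i \<in> I. col i}. r = a i"
    using pos_s_t(4)[of r] same_colour_orthogonal by (intro root_on_orthogonal_simples[OF r]) auto
  then show ?thesis by blast
qed

lemma white_root:
  assumes r: "r \<in> R" and p: "p r = - of_real c * cis (- \<phi>)" "c > 0"
  shows "\<exists>i\<in>I. \<not> col i \<and> r = a i"
proof -
  have Im: "Im (p r) = c * sin \<phi>" and Re: "Re (p r) = - c * cos \<phi>" using p(1) by simp_all
  then have t: "t r = c" using Im_p[of r] sin_phi by simp
  then have s: "s r = 0" using Re_p[of r] Re by simp
  have "pos r"
  proof (rule ccontr)
    assume "\<not> pos r"
    then have "pos (- r)" using root_not_pos[OF r] by simp
    then show False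
      using p_nonneg(1)[of "- r"] mult_pos_pos[OF p(2) sin_phi] Im by (simp add: linear_neg[OF linear_p])
  qed
  then have "\<exists>i\<in>{i \<in> I. \<not> col i}. r = a i"
    using pos_s_t(3)[of r] s same_colour_orthogonal by (intro root_on_orthogonal_simples[OF r]) auto
  then show ?thesis by blast
qed

text \<open>Unless \<open>C r\<close> is black simple, it has a positive white coordinate, which
  \<open>sB\<close> does not change, so \<open>sD r\<close> is positive. Its black coordinates are
  those of the negative root \<open>r\<close> and hence vanish, so \<open>sD r\<close> is a white
  simple root.\<close>

lemma sign_change:
  assumes r: "r \<in> R" "pos (- r)" "pos (C r)"
  shows "\<exists>k\<in>I. C r = bvec I a C k"
proof (cases "\<exists>i\<in>{i \<in> I. col i}. C r = a i")
  case True
  then show ?thesis using bvec_bipartite by auto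
next
  case False
  have CR: "C r \<in> R" and dR: "sD r \<in> R" using weyl_in_R[OF C_weyl r(1)] weyl_in_R[OF sD_weyl r(1)] by auto
  have "\<exists>k\<in>I. \<not> col k \<and> C r \<bullet> \<omega> k \<noteq> 0"
    using root_on_orthogonal_simples[OF CR r(3), of "{i \<in> I. col i}"] False same_colour_orthogonal by auto
  then obtain k where k: "k \<in> I" "\<not> col k" "C r \<bullet> \<omega> k \<noteq> 0" by blast
  then have "C r \<bullet> \<omega> k > 0" using r(3) by (force simp: pos_def)
  then have "sD r \<bullet> \<omega> k > 0" using sB(5)[of k "sD r"] k by (simp add: C)
  then have pd: "pos (sD r)" using posI[OF dR k(1)] by simp
  have "sD r \<bullet> \<omega> k = 0" if "k \<in> I" "col k" for k
  proof -
    have "sD r \<bullet> \<omega> k = r \<bullet> \<omega> k" using sD(5)[of k r] that by simp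
    then show ?thesis using pd r(2) that by (force simp: pos_def)
  qed
  then have "\<exists>j\<in>{i \<in> I. \<not> col i}. sD r = a j"
    using same_colour_orthogonal by (intro root_on_orthogonal_simples[OF dR pd]) auto
  then obtain j where j: "j \<in> I" "\<not> col j" "sD r = a j" by blast
  then have "C r = bvec I a C j" by (simp add: bvec_bipartite C)
  then show ?thesis using j by blast
qed

text \<open>An orbit avoiding these roots never turns from negative to positive and, being periodic,
  has constant sign. Its sum over a period is fixed by \<open>C\<close>, so \<open>p\<close> kills
  it because the rotation is nontrivial; yet \<open>p\<close> kills no nonzero vector with
  coordinates of one sign.\<close>

lemma orbit_hits_bvec:
  assumes r: "r \<in> R"
  shows "\<exists>n. \<exists>k\<in>I. (C ^^ n) r = bvec I a C k"
proof (rule ccontr)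
  assume no: "\<not> ?thesis"
  obtain N where N: "N > 0" "C ^^ N = id" using weyl_finite_order[OF C_weyl] .
  have root: "(C ^^ n) r \<in> R" for n using weyl_in_R[OF weyl_funpow[OF C_weyl] r] .
  have step: "pos (- (C ^^ Suc n) r)" if "pos (- (C ^^ n) r)" for n
  proof (rule ccontr)
    assume "\<not> ?thesis"
    then have "pos (C ((C ^^ n) r))"
      using root_not_pos[OF root[of "Suc n"]] by auto
    then have "\<exists>k\<in>I. C ((C ^^ n) r) = bvec I a C k" by (rule sign_change[OF root that])
    then obtain k where "k \<in> I" "C ((C ^^ n) r) = bvec I a C k" by blast
    then have "(C ^^ Suc n) r = bvec I a C k" by simp
    then show False using no \<open>k \<in> I\<close> by blast
  qed
  have const: "(\<forall>n. pos ((C ^^ n) r)) \<or> (\<forall>n. pos (- (C ^^ n) r))"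
  proof (cases "\<forall>n. pos ((C ^^ n) r)")
    case False
    then obtain m where m: "pos (- (C ^^ m) r)" using root_not_pos[OF root] by blast
    have after: "pos (- (C ^^ (m + n)) r)" for n
      by (induction n) (use m step in auto)
    \<comment> \<open>Adding \<open>m\<close> full periods puts the index \<open>n\<close> past
      \<open>m\<close>, so negativity from \<open>m\<close> on covers the whole orbit.\<close>
    have "pos (- (C ^^ n) r)" for n
    proof -
      have "C ^^ (N * m) = id" by (simp add: funpow_mult[symmetric] N(2))
      then have "(C ^^ (n + N * m)) r = (C ^^ n) r" by (simp add: funpow_add)
      moreover have "n + N * m = m + (n + (N - 1) * m)" using N(1) by (cases N) auto
      ultimately show ?thesis using after[of "n + (N - 1) * m"] by metis
    qed
    then show ?thesis by blast
  qed simp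
  define v where "v = (\<Sum>n<N. (C ^^ n) r)"
  have "C v = (\<Sum>n<N. (C ^^ Suc n) r)"
    by (simp add: v_def linear_sum[OF weyl_linear[OF C_weyl]])
  also have "\<dots> = v"
    using sum.lessThan_Suc_shift[of "\<lambda>n. (C ^^ n) r" N] N(2) by (simp add: v_def)
  finally have "cis (2 * \<phi>) * p v = p v" using p_C[of v] by simp
  moreover have "cis (2 * \<phi>) \<noteq> 1"
  proof
    assume "cis (2 * \<phi>) = 1"
    then have "cos (2 * \<phi>) = 1" by (simp add: complex_eq_iff)
    then have "(sin \<phi>)\<^sup>2 = 0" by (simp add: cos_double_sin)
    then show False using sin_phi by simp
  qed
  ultimately have pv: "p v = 0" by simp
  \<comment> \<open>The scalar \<open>e\<close> will be 1 or -1, for the two possible signs.\<close>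
  have zero: False if "\<And>n. pos (e *\<^sub>R (C ^^ n) r)" "e \<noteq> 0" for e :: real
  proof -
    have coord: "(e *\<^sub>R v) \<bullet> \<omega> i = (\<Sum>n<N. (e *\<^sub>R (C ^^ n) r) \<bullet> \<omega> i)" for i
      by (simp add: v_def inner_sum_left sum_distrib_left)
    have nn: "(e *\<^sub>R (C ^^ n) r) \<bullet> \<omega> i \<ge> 0" if "i \<in> I" for i n
      using \<open>\<And>n. pos (e *\<^sub>R (C ^^ n) r)\<close>[of n] that unfolding pos_def by blast
    have "pos (e *\<^sub>R v)" unfolding pos_def coord using nn by (auto intro!: sum_nonneg simp del: inner_scaleR_left)
    then have "e *\<^sub>R v = 0" by (rule pos_p_zero) (simp add: linear_scale[OF linear_p] pv)
    have "(e *\<^sub>R r) \<bullet> \<omega> i = 0" if "i \<in> I" for i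
    proof -
      have "(\<Sum>n<N. (e *\<^sub>R (C ^^ n) r) \<bullet> \<omega> i) = 0"
        using coord[of i] unfolding \<open>e *\<^sub>R v = 0\<close> by (simp only: inner_zero_left)
      then have "\<forall>n\<in>{..<N}. (e *\<^sub>R (C ^^ n) r) \<bullet> \<omega> i = 0"
        using nn[OF that] by (subst (asm) sum_nonneg_eq_0_iff) auto
      then show ?thesis using N(1) by (metis funpow_0 lessThan_iff)
    qed
    then have "e *\<^sub>R r = 0" using coord_eqI[of "e *\<^sub>R r" 0] by simp
    then show False using \<open>e \<noteq> 0\<close> r zero_notin by auto
  qed
  show False using const zero[of 1] zero[of "- 1"] by auto
qed

text \<open>Both boundary rays of the sector are preserved, so simple roots go to simple roots and
  rigidity applies.\<close>

lemma weyl_scaling_pos: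
  assumes w: "w \<in> weyl_group R" and p: "\<And>v. p (w v) = of_real c * p v" "c > 0"
  shows "w v = v"
proof -
  have "w (a i) \<in> a ` I" if i: "i \<in> I" for i
  proof (cases "col i")
    case True
    have "p (w (a i)) = of_real (c * x i)" using p(1) p_a[OF i] True by simp
    then show ?thesis
      using black_root[OF weyl_in_R[OF w a_in_R[OF i]]] mult_pos_pos[OF p(2) x_pos[OF i]] by blast
  next
    case False
    have "p (w (a i)) = - of_real (c * x i) * cis (- \<phi>)" using p(1) p_a[OF i] False by simp
    then show ?thesis
      using white_root[OF weyl_in_R[OF w a_in_R[OF i]]] mult_pos_pos[OF p(2) x_pos[OF i]] by blast
  qed
  then have "w ` a ` I \<subseteq> a ` I" by blast
  then have "w (a i) = id (a i)" if "i \<in> I" for i using rigid[OF w _ that] by simp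
  then have "w v = id v"
    using linear_eqI[OF weyl_linear[OF w] linear_id] by blast
  then show ?thesis by simp
qed

text \<open>A rotation by \<open>\<phi>\<close> would move the walls of one colour to those of the other; composed with
  \<open>sB\<close> it would permute the simple roots while exchanging the colours.\<close>

lemma weyl_scaling_phi:
  assumes w: "w \<in> weyl_group R" and p: "\<And>v. p (w v) = of_real c * cis \<phi> * p v" "c > 0"
  shows False
proof -
  let ?w = "sB \<circ> w"
  have W: "?w \<in> weyl_group R" by (rule weyl_comp[OF sB_weyl w])
  have pw: "p (?w v) = - of_real c * cis (- \<phi>) * cnj (p v)" for v
    by (simp add: p_sB p(1) cis_cnj)
  have swap: "\<exists>j\<in>I. col j = (\<not> col i) \<and> ?w (a i) = a j" if i: "i \<in> I" for i
  proof (cases "col i")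
    case True
    have "p (?w (a i)) = - of_real (c * x i) * cis (- \<phi>)" unfolding pw using p_a[OF i] True by simp
    then show ?thesis
      using white_root[OF weyl_in_R[OF W a_in_R[OF i]]] mult_pos_pos[OF p(2) x_pos[OF i]] True by blast
  next
    case False
    have "p (?w (a i)) = of_real (c * x i)" unfolding pw using p_a[OF i] False by (simp add: cis_cnj cis_mult)
    then show ?thesis
      using black_root[OF weyl_in_R[OF W a_in_R[OF i]]] mult_pos_pos[OF p(2) x_pos[OF i]] False by blast
  qed
  obtain i where i: "i \<in> I" using I_nonempty by blast
  have "?w ` a ` I \<subseteq> a ` I" using swap by blast
  then have "?w (a i) = a i" using rigid[OF W _ i] by blast
  then show False using swap[OF i] inj_a i by (metis inj_onD)
qed

lemma p_bvec: "k \<in> I \<Longrightarrow> p (bvec I a C k) = of_real (x k) * (if col k then 1 else cis \<phi>)"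
  by (simp add: bvec_bipartite p_a p_sB cis_cnj)

text \<open>Black \<open>bvec\<close> lie at angle 0 and white ones at angle \<phi>, so
  \<open>w\<close> rotates by 0, \<phi> or -\<phi>. The last two, which belong to different colours,
  are excluded by \<open>weyl_scaling_phi\<close>.\<close>

lemma weyl_scaling_bvec:
  assumes w: "w \<in> weyl_group R" and p: "\<And>v. p (w v) = c * p v"
    and ij: "i \<in> I" "j \<in> I" "w (bvec I a C i) = bvec I a C j"
  shows "w v = v"
proof -
  have xi: "x i > 0" "x j > 0" using x_pos ij by auto
  have eq: "c * (of_real (x i) * (if col i then 1 else cis \<phi>)) = of_real (x j) * (if col j then 1 else cis \<phi>)"
    using p[of "bvec I a C i"] ij by (simp add: p_bvec)
  have cis_inv: "cis \<phi> * cis (- \<phi>) = 1" by (simp add: cis_mult)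
  have "\<not> (\<not> col i \<and> col j)"
  proof
    assume h: "\<not> col i \<and> col j"
    have "c * of_real (x i) = c * (of_real (x i) * cis \<phi>) * cis (- \<phi>)" using cis_inv by simp
    also have "\<dots> = of_real (x j) * cis (- \<phi>)" using eq h by simp
    finally have "c = of_real (x j / x i) * cis (- \<phi>)" using xi by (simp add: field_simps)
    \<comment> \<open>Composing with \<open>C\<close> adds 2\<phi> and turns the rotation by -\<phi>
      into one by \<phi>.\<close>
    then have "p ((C \<circ> w) v) = of_real (x j / x i) * cis \<phi> * p v" for v
      by (simp add: p_C p cis_mult)
    then show False using weyl_scaling_phi[OF weyl_comp[OF C_weyl w]] xi by (meson divide_pos_pos)
  qed
  moreover have "\<not> (col i \<and> \<not> col j)"
  proof
    assume "col i \<and> \<not> col j"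
    then have "c = of_real (x j / x i) * cis \<phi>" using eq xi by (simp add: field_simps)
    then show False using weyl_scaling_phi[OF w] p xi by (meson divide_pos_pos)
  qed
  ultimately have "col i = col j" by blast
  then have "c * of_real (x i) = of_real (x j)" using eq by (auto split: if_splits)
  then have "c = of_real (x j / x i)" using xi by (simp add: field_simps)
  then show ?thesis using weyl_scaling_pos[OF w] p xi by (meson divide_pos_pos)
qed

lemma bvec_inj: "inj_on (bvec I a C) I"
proof (rule inj_onI)
  fix i j assume ij: "i \<in> I" "j \<in> I" "bvec I a C i = bvec I a C j"
  have "col k \<longleftrightarrow> Im (p (bvec I a C k)) = 0" if "k \<in> I" for k
    using x_pos[OF that] sin_phi by (simp add: p_bvec that)
  then have "col i = col j" using ij by metis
  then have "a i = a j" using ij by (auto simp: bvec_bipartite split: if_splits) (metis sB_sB)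
  then show "i = j" using inj_a ij by (simp add: inj_on_eq_iff)
qed

lemma orbit_unique_bvec:
  assumes "i \<in> I" "j \<in> I" "(C ^^ n) (bvec I a C i) = bvec I a C j"
  shows "i = j"
  using weyl_scaling_bvec[OF weyl_funpow[OF C_weyl] p_funpow_C assms] assms bvec_inj
  by (simp add: inj_on_eq_iff)

text \<open>Together with \<open>p\<close>, the map \<open>p \<circ> w\<close> is an eigenfunctional
  of \<open>C\<close> for \<open>cis (2 * \<phi>)\<close>. On simple roots this becomes an
  eigenvector equation for the diagram with the Perron eigenvalue, whose solutions are the multiples
  of \<open>x\<close>.\<close>

lemma commuting_scaling:
  assumes w: "w \<in> weyl_group R" and comm: "\<And>v. w (C v) = C (w v)"
  shows "\<exists>c. \<forall>v. p (w v) = c * p v"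
proof -
  define q where "q v = p (w v)" for v
  \<comment> \<open>The white factor is the inverse of the factor \<open>- cis (- \<phi>)\<close> in
    \<open>p_a\<close>, so that \<open>q = p\<close> would give \<open>z = x\<close>.\<close>
  define z where "z i = (if col i then q (a i) else - cis \<phi> * q (a i))" for i
  have lin: "linear q" unfolding q_def
    using linear_compose[OF weyl_linear[OF w] linear_p] by (simp add: o_def)
  have qC: "q (C v) = cis (2 * \<phi>) * q v" for v by (simp add: q_def comm p_C)
  have inv: "cis (2 * \<phi>) * cis (- \<phi>) = cis \<phi>" "cis \<phi> * cis \<phi> = cis (2 * \<phi>)" "cis \<phi> * cis (- \<phi>) = 1"
    by (simp_all add: cis_mult)
  have z: "(\<Sum>j\<in>nb i. z j) = (2 * cos \<phi>) *\<^sub>R z i" if i: "i \<in> I" for i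
  proof -
    have sum: "(\<Sum>j\<in>nb i. z j) = (if col i then - cis \<phi> else 1) * q (\<Sum>j\<in>nb i. a j)"
      unfolding linear_sum[OF lin] sum_distrib_left using nb_colour[OF i] by (intro sum.cong) (auto simp: z_def)
    show ?thesis
    proof (cases "col i")
      case True
      \<comment> \<open>Evaluating at \<open>sD (a i)\<close> cancels the \<open>sD\<close> inside
        \<open>C\<close> and leaves \<open>sB\<close>, which negates a black root.\<close>
      have "C (sD (a i)) = - a i" using i True by (simp add: C sD_sD sB_a)
      then have "cis (2 * \<phi>) * (q (a i) + q (\<Sum>j\<in>nb i. a j)) = - q (a i)"
        using qC[of "sD (a i)"] i True by (simp add: sD_a linear_add[OF lin] linear_neg[OF lin])
      then have "cis (- \<phi>) * (cis (2 * \<phi>) * (q (a i) + q (\<Sum>j\<in>nb i. a j))) = - cis (- \<phi>) * q (a i)"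
        by simp
      then have e: "cis \<phi> * (q (a i) + q (\<Sum>j\<in>nb i. a j)) = - cis (- \<phi>) * q (a i)"
        using inv(1) by (simp add: mult.assoc[symmetric] mult.commute)
      have "- cis \<phi> * q (\<Sum>j\<in>nb i. a j)
          = cis \<phi> * q (a i) - cis \<phi> * (q (a i) + q (\<Sum>j\<in>nb i. a j))" by (simp add: algebra_simps)
      also have "\<dots> = (cis \<phi> + cis (- \<phi>)) * q (a i)" unfolding e by (simp add: algebra_simps)
      finally have "- cis \<phi> * q (\<Sum>j\<in>nb i. a j) = (cis \<phi> + cis (- \<phi>)) * q (a i)" .
      then show ?thesis
        unfolding sum scaleR_conv_of_real two_cos using True by (simp add: z_def)
    next
      case False
      have "C (a i) = - (a i + (\<Sum>j\<in>nb i. a j))"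
        using i False linear_neg[OF linear_sum_refl] by (simp add: C sD_a sB_a)
      then have "cis (2 * \<phi>) * q (a i) = - (q (a i) + q (\<Sum>j\<in>nb i. a j))"
        using qC[of "a i"] by (simp add: linear_add[OF lin] linear_neg[OF lin] linear_diff[OF lin])
      then have "q (\<Sum>j\<in>nb i. a j) = - (cis (2 * \<phi>) + 1) * q (a i)"
        by (simp add: algebra_simps add_eq_0_iff2)
      also have "\<dots> = (cis \<phi> + cis (- \<phi>)) * (- cis \<phi> * q (a i))"
      proof -
        have "(cis \<phi> + cis (- \<phi>)) * (- cis \<phi> * u) = - (cis \<phi> * cis \<phi> + cis \<phi> * cis (- \<phi>)) * u" for u
          by (simp add: algebra_simps)
        then show ?thesis by (simp only: inv)
      qed
      finally show ?thesis
        unfolding sum scaleR_conv_of_real two_cos using False by (simp add: z_def)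
    qed
  qed
  have zRe: "(\<Sum>j\<in>nb i. Re (z j)) = 2 * cos \<phi> * Re (z i)"
    and zIm: "(\<Sum>j\<in>nb i. Im (z j)) = 2 * cos \<phi> * Im (z i)" if "i \<in> I" for i
    using arg_cong[OF z[OF that], of Re] arg_cong[OF z[OF that], of Im] by simp_all
  obtain c1 c2 where c: "\<forall>i\<in>I. Re (z i) = c1 * x i" "\<forall>i\<in>I. Im (z i) = c2 * x i"
    using perron_simple[OF x_pos x_eig zRe] perron_simple[OF x_pos x_eig zIm] by blast
  let ?c = "Complex c1 c2"
  have zc: "z i = ?c * of_real (x i)" if "i \<in> I" for i using c that by (simp add: complex_eq_iff)
  have "q v = ?c * p v" for v
  proof (rule linear_eqI[OF lin])
    show "linear (\<lambda>v. ?c * p v)"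
      by (rule linearI) (simp_all add: linear_add[OF linear_p] linear_scale[OF linear_p] distrib_left)
    fix i assume i: "i \<in> I"
    show "q (a i) = ?c * p (a i)"
    proof (cases "col i")
      case True
      then show ?thesis using zc[OF i] p_a[OF i] by (simp add: z_def)
    next
      case False
      have "q (a i) = - cis (- \<phi>) * (- cis \<phi> * q (a i))" using inv(3) by (simp add: mult.assoc[symmetric] mult.commute)
      also have "\<dots> = - cis (- \<phi>) * z i" using False by (simp add: z_def)
      finally show ?thesis using zc[OF i] p_a[OF i] False by (simp only: if_False) simp
    qed
  qed
  then show ?thesis unfolding q_def by blast
qed

text \<open>Some power of \<open>C\<close> brings the \<open>w\<close>-image of one
  \<open>bvec\<close> back to a \<open>bvec\<close>. That power composed with \<open>w\<close> is
  scalar on the plane, hence trivial, and \<open>w\<close> is its inverse.\<close>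

lemma commuting_power:
  assumes w: "w \<in> weyl_group R" and comm: "\<And>v. w (C v) = C (w v)"
  shows "\<exists>n. \<forall>v. w v = (C ^^ n) v"
proof -
  obtain c where c: "\<And>v. p (w v) = c * p v" using commuting_scaling[OF assms] by blast
  obtain i where i: "i \<in> I" using I_nonempty by blast
  have "bvec I a C i \<in> R"
    using i bvec_bipartite a_in_R weyl_in_R[OF sB_weyl] by auto
  then obtain n k where nk: "k \<in> I" "(C ^^ n) (w (bvec I a C i)) = bvec I a C k"
    using orbit_hits_bvec[OF weyl_in_R[OF w]] by blast
  have inv: "((C ^^ n) \<circ> w) v = v" for v
  proof (rule weyl_scaling_bvec[OF weyl_comp[OF weyl_funpow[OF C_weyl] w]])
    show "p (((C ^^ n) \<circ> w) v) = (cis (2 * \<phi>) ^ n * c) * p v" for v by (simp add: p_funpow_C c)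
    show "((C ^^ n) \<circ> w) (bvec I a C i) = bvec I a C k" using nk by simp
  qed (use i nk in auto)
  obtain N where N: "N > 0" "C ^^ N = id" using weyl_finite_order[OF C_weyl] .
  have "w v = (C ^^ ((N - 1) * n)) v" for v
  proof -
    have "(N - 1) * n + n = N * n" using N(1) by (cases N) auto
    then have "(C ^^ ((N - 1) * n)) ((C ^^ n) (w v)) = (C ^^ (N * n)) (w v)" by (metis comp_apply funpow_add)
    also have "\<dots> = w v" by (simp add: funpow_mult[symmetric] N(2))
    finally show ?thesis using inv[of v] by simp
  qed
  then show ?thesis by blast
qed

end

context bipartite_coxeter
begin

lemma coxeter_plane_exists: "\<exists>x \<phi>. coxeter_plane R I a col C x \<phi>"
proof -
  obtain x l where x: "\<And>i. i \<in> I \<Longrightarrow> x i > (0::real)"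
    "\<And>i. i \<in> I \<Longrightarrow> (\<Sum>j\<in>nb i. x j) = l * x i" "0 \<le> l" "l < 2"
    using perron_vector by blast
  \<comment> \<open>The bounds \<open>0 \<le> l\<close> and \<open>l < 2\<close> place the angle in
    the range demanded of \<phi>; \<pi>/2 is reached when \<open>l = 0\<close>, as in rank
    one.\<close>
  have c: "cos (arccos (l / 2)) = l / 2" using x by simp
  have "0 < arccos (l / 2)" using x arccos_less_arccos[of "l / 2" 1] by simp
  moreover have "arccos (l / 2) \<le> pi / 2" using x arccos_le_arccos[of 0 "l / 2"] by simp
  ultimately show ?thesis
    using x c by (intro exI[of _ x] exI[of _ "arccos (l / 2)"], unfold_locales) auto
qed

lemma bvec_orbits:
  "r \<in> R \<Longrightarrow> \<exists>n. \<exists>k\<in>I. (C ^^ n) r = bvec I a C k"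
  "i \<in> I \<Longrightarrow> j \<in> I \<Longrightarrow> (C ^^ n) (bvec I a C i) = bvec I a C j \<Longrightarrow> i = j"
  "w \<in> weyl_group R \<Longrightarrow> (\<And>v. w (C v) = C (w v)) \<Longrightarrow> \<exists>n. \<forall>v. w v = (C ^^ n) v"
  using coxeter_plane_exists coxeter_plane.orbit_hits_bvec coxeter_plane.orbit_unique_bvec
    coxeter_plane.commuting_power by metis+

end

section \<open>Labelled simple systems\<close>

locale labelled_roots = sl_roots R
  for R :: "'a::euclidean_space set" +
  fixes I :: "'i set" and lab :: "'a set \<Rightarrow> 'i \<Rightarrow> 'a"
  assumes irr: "irreducible_roots R" and labelling: "labelling R I lab"
begin

lemma lab_base: "simple_system R \<Delta> \<Longrightarrow> simple_base R I (lab \<Delta>)"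
  using labelling by unfold_locales (auto simp: labelling_def bij_betw_def)

lemma lab_image: "simple_system R \<Delta> \<Longrightarrow> lab \<Delta> ` I = \<Delta>"
  using labelling by (auto simp: labelling_def bij_betw_def)

lemma lab_weyl: "simple_system R \<Delta> \<Longrightarrow> w \<in> weyl_group R \<Longrightarrow> i \<in> I \<Longrightarrow> lab (w ` \<Delta>) i = w (lab \<Delta> i)"
  using labelling by (auto simp: labelling_def)

lemma simple_system_weyl: "simple_system R \<Delta> \<Longrightarrow> w \<in> weyl_group R \<Longrightarrow> simple_system R (w ` \<Delta>)"
  using simple_base.simple[OF simple_base.simple_base_weyl[OF lab_base]] lab_image
  by (metis image_comp)

lemma beta_eq_bvec:
  assumes \<Delta>: "simple_system R \<Delta>" and "is": "expression_for I lab C \<Delta> is" and i: "i \<in> I"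
  shows "beta I lab C \<Delta> i = bvec I (lab \<Delta>) C i"
proof -
  interpret simple_base R I "lab \<Delta>" by (rule lab_base[OF \<Delta>])
  have word: "expression_for I lab C \<Delta> js \<longleftrightarrow> cox_word I (lab \<Delta>) C js" for js
    by (simp add: expression_for_def cox_word_def)
  \<comment> \<open>The existential over expressions becomes a union of word orders; these all
    coincide, so one word describes the orientation.\<close>
  have "orientation I lab C \<Delta> = (\<Union>js\<in>{js. cox_word I (lab \<Delta>) C js}. word_order js)"
    using a_norm2 by (fastforce simp: orientation_def dynkin_n_def word word_order_def)
  also have "\<dots> = word_order is"
    using word_order_unique "is" unfolding word by blast
  finally show ?thesis
    using bvec_sum[of C "is" i] "is" i unfolding beta_def word by simp
qed

definition bipartite_form :: "('i \<Rightarrow> bool) \<Rightarrow> ('a \<Rightarrow> 'a) \<Rightarrow> 'a set \<Rightarrow> bool" where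
  "bipartite_form col C \<Delta> \<longleftrightarrow> simple_system R \<Delta> \<and> bipartite_coxeter R I (lab \<Delta>) col C"

lemma bipartite_form_exists:
  assumes \<Delta>: "simple_system R \<Delta>" and "is": "expression_for I lab C \<Delta> is"
    and "\<forall>i\<in>I. \<forall>j\<in>I. lab \<Delta> i \<bullet> lab \<Delta> j = - 1 \<longrightarrow> col j = (\<not> col i)"
  shows "\<exists>\<Delta>1. bipartite_form col C \<Delta>1 \<and>
    (\<forall>k\<in>I. \<exists>n. bvec I (lab \<Delta>1) C k = (C ^^ n) (beta I lab C \<Delta> k))"
proof -
  interpret simple_base R I "lab \<Delta>" by (rule lab_base[OF \<Delta>])
  note col = assms(3)[rule_format]
  have word: "cox_word I (lab \<Delta>) C is" using "is" by (simp add: expression_for_def cox_word_def)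
  then have dist: "distinct is" and set: "set is = I" by (auto simp: cox_word_def)
  define \<kappa> :: "'i \<Rightarrow> int" where "\<kappa> i = (if col i then 0 else 1)" for i
  define \<sigma> :: "'i \<Rightarrow> 'i \<Rightarrow> int" where "\<sigma> i j = (if precedes is i j then 1 else - 1)" for i j
  \<comment> \<open>The height \<open>\<kappa> + 2 * m\<close> has the parity of the colouring, and
    \<open>g\<close> solves \<open>h j = h i + \<sigma> i j\<close> for \<open>m j\<close>. The
    division is exact on edges, where both \<open>\<kappa> i - \<kappa> j\<close> and
    \<open>\<sigma> i j\<close> are odd.\<close>
  define g where "g i j m = m + (\<kappa> i - \<kappa> j + \<sigma> i j) div 2" for i j m
  have g: "g j i (g i j m) = m" "\<kappa> j + 2 * g i j m = \<kappa> i + 2 * m + \<sigma> i j"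
    if "i \<in> I" "j \<in> I" "lab \<Delta> i \<bullet> lab \<Delta> j = - 1" for i j m
  proof -
    have "i \<noteq> j" using that a_norm2 by auto
    then have "\<sigma> j i = - \<sigma> i j"
      using precedes_total[of i "is" j] precedes_trans[OF dist] precedes_irrefl[OF dist] that set
      unfolding \<sigma>_def by auto
    then have "\<kappa> j - \<kappa> i + \<sigma> j i = - (\<kappa> i - \<kappa> j + \<sigma> i j)" by simp
    moreover have "even (\<kappa> i - \<kappa> j + \<sigma> i j)" using col[OF that] by (auto simp: \<kappa>_def \<sigma>_def)
    then obtain e where "\<kappa> i - \<kappa> j + \<sigma> i j = 2 * e" by blast
    ultimately show "g j i (g i j m) = m" "\<kappa> j + 2 * g i j m = \<kappa> i + 2 * m + \<sigma> i j"
      unfolding g_def by auto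
  qed
  obtain m where m: "\<forall>i\<in>I. \<forall>j\<in>I. lab \<Delta> i \<bullet> lab \<Delta> j = - 1 \<longrightarrow> m j = g i j (m i)"
    using forest_extension[of g I] g(1) by blast
  define h where "h i = \<kappa> i + 2 * m i" for i
  \<comment> \<open>Any even upper bound of the heights would serve.\<close>
  define M where "M = 2 * (\<Sum>i\<in>I. \<bar>h i\<bar>)"
  obtain w js where w: "w \<in> weyl_group R" "cox_word I (w \<circ> lab \<Delta>) C js"
    "\<And>i j. precedes js i j \<Longrightarrow> lab \<Delta> i \<bullet> lab \<Delta> j = - 1 \<Longrightarrow> col i"
    "\<And>k. k \<in> I \<Longrightarrow> \<exists>n. bvec I (w \<circ> lab \<Delta>) C k = (C ^^ n) (bvec I (lab \<Delta>) C k)"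
  proof -
    have "\<exists>w\<in>weyl_group R. \<exists>js. cox_word I (w \<circ> lab \<Delta>) C js \<and>
      (\<forall>i j. precedes js i j \<longrightarrow> lab \<Delta> i \<bullet> lab \<Delta> j = - 1 \<longrightarrow> col i) \<and>
      (\<forall>k\<in>I. \<exists>n. bvec I (w \<circ> lab \<Delta>) C k = (C ^^ n) (bvec I (lab \<Delta>) C k))"
    proof (rule reach_bipartite_word[OF simple_base_axioms word])
      fix i j assume ij: "precedes is i j" "lab \<Delta> i \<bullet> lab \<Delta> j = - 1"
      have "i \<in> I" "j \<in> I" using precedes_in_set[OF ij(1)] set by auto
      then show "h j = h i + 1" using g(2)[of i j "m i"] m ij by (simp add: h_def \<sigma>_def)
    next
      show "even (h i) \<longleftrightarrow> col i" for i by (simp add: h_def \<kappa>_def)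
      show "even M" by (simp add: M_def)
      fix i assume i: "i \<in> I"
      have "\<bar>h i\<bar> \<le> (\<Sum>i\<in>I. \<bar>h i\<bar>)" using i finite_I by (intro member_le_sum) auto
      then show "h i \<le> M + 1" unfolding M_def by linarith
    qed
    then show thesis using that by blast
  qed
  define \<Delta>1 where "\<Delta>1 = w ` \<Delta>"
  have \<Delta>1: "simple_system R \<Delta>1" unfolding \<Delta>1_def by (rule simple_system_weyl[OF \<Delta> w(1)])
  have lab1: "lab \<Delta>1 i = (w \<circ> lab \<Delta>) i" if "i \<in> I" for i
    unfolding \<Delta>1_def using lab_weyl[OF \<Delta> w(1) that] by simp
  interpret A: simple_base R I "lab \<Delta>1" by (rule lab_base[OF \<Delta>1])
  have inner1: "lab \<Delta>1 i \<bullet> lab \<Delta>1 j = lab \<Delta> i \<bullet> lab \<Delta> j" if "i \<in> I" "j \<in> I" for i j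
    using lab1 that weyl_inner[OF w(1)] by simp
  have dual1: "dual_basis I (lab \<Delta>1) = dual_basis I (w \<circ> lab \<Delta>)"
    unfolding dual_basis_def using lab1 by (simp cong: ball_cong)
  have setj: "set js = I" using w(2) by (simp add: cox_word_def)
  have "map (lab \<Delta>1) js = map (w \<circ> lab \<Delta>) js" using lab1 setj by simp
  then have word1: "cox_word I (lab \<Delta>1) C js" using w(2) unfolding cox_word_def by metis
  have col1: "col j = (\<not> col i)" if "i \<in> I" "j \<in> I" "lab \<Delta>1 i \<bullet> lab \<Delta>1 j = - 1" for i j
    using col that inner1 by simp
  have "bipartite_coxeter R I (lab \<Delta>1) col C"
  proof unfold_locales
    show "irreducible_roots R" by (rule irr)
    show "col j = (\<not> col i)" if "i \<in> I" "j \<in> I" "lab \<Delta>1 i \<bullet> lab \<Delta>1 j = - 1" for i j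
      by (rule col1[OF that])
    show "C v = sum_refl (lab \<Delta>1) {i \<in> I. col i} (sum_refl (lab \<Delta>1) {i \<in> I. \<not> col i} v)" for v
    proof (rule A.bipartite_word[OF word1])
      fix i j assume "precedes js i j" "lab \<Delta>1 i \<bullet> lab \<Delta>1 j = - 1"
      then show "col i" using w(3)[of i j] inner1 precedes_in_set[of js i j] setj by simp
    qed (rule col1)
    fix u i assume u: "u \<in> weyl_group R" "u ` lab \<Delta>1 ` I \<subseteq> lab \<Delta>1 ` I" "i \<in> I"
    have im: "lab \<Delta>1 ` I = \<Delta>1" by (rule lab_image[OF \<Delta>1])
    \<comment> \<open>Finiteness makes \<open>u\<close> map the simple system onto itself, so
      equivariance compares labels within one system.\<close>
    have "inj_on u \<Delta>1" using weyl_inj[OF u(1)] by (rule inj_on_subset) simp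
    then have "u ` \<Delta>1 = \<Delta>1"
      using u(2) A.finite_I im by (metis endo_inj_surj finite_imageI)
    then show "u (lab \<Delta>1 i) = lab \<Delta>1 i" using lab_weyl[OF \<Delta>1 u(1,3)] by simp
  qed
  moreover have "\<exists>n. bvec I (lab \<Delta>1) C k = (C ^^ n) (beta I lab C \<Delta> k)" if "k \<in> I" for k
    using w(4)[OF that] beta_eq_bvec[OF \<Delta> "is" that] by (simp add: bvec_def dual1)
  ultimately show ?thesis using \<Delta>1 unfolding bipartite_form_def by blast
qed

lemma bipartite_form_bij:
  assumes "bipartite_form col C \<Delta>"
  shows "bij_betw (\<lambda>i. cyc_orbit C (bvec I (lab \<Delta>) C i)) I (orbit_set R C)"
proof -
  interpret bipartite_coxeter R I "lab \<Delta>" col C using assms by (simp add: bipartite_form_def)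
  obtain N where N: "N > 0" "C ^^ N = id" using weyl_finite_order[OF C_weyl] .
  have root: "bvec I (lab \<Delta>) C i \<in> R" if "i \<in> I" for i
    using that bvec_bipartite a_in_R weyl_in_R[OF sB_weyl] by auto
  show ?thesis
  proof (intro bij_betw_imageI inj_onI equalityI subsetI)
    fix i j assume ij: "i \<in> I" "j \<in> I"
      "cyc_orbit C (bvec I (lab \<Delta>) C i) = cyc_orbit C (bvec I (lab \<Delta>) C j)"
    have "(C ^^ 0) (bvec I (lab \<Delta>) C j) \<in> cyc_orbit C (bvec I (lab \<Delta>) C i)"
      unfolding ij(3) unfolding cyc_orbit_finite_order[OF N] by blast
    then obtain n where "(C ^^ n) (bvec I (lab \<Delta>) C i) = bvec I (lab \<Delta>) C j"
      unfolding cyc_orbit_finite_order[OF N] by force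
    then show "i = j" by (rule bvec_orbits(2)[OF ij(1,2)])
  next
    fix X assume "X \<in> (\<lambda>i. cyc_orbit C (bvec I (lab \<Delta>) C i)) ` I"
    then show "X \<in> orbit_set R C" using root by (auto simp: orbit_set_def)
  next
    fix X assume "X \<in> orbit_set R C"
    then obtain r where r: "r \<in> R" "X = cyc_orbit C r" by (auto simp: orbit_set_def)
    then obtain n k where "k \<in> I" "bvec I (lab \<Delta>) C k = (C ^^ n) r" using bvec_orbits(1) by metis
    then show "X \<in> (\<lambda>i. cyc_orbit C (bvec I (lab \<Delta>) C i)) ` I"
      using cyc_orbit_eq[OF N] r(2) by blast
  qed
qed

text \<open>The Weyl group element between the two systems preserves labels and therefore colours.
  It thus intertwines the two bipartite formulas for \<open>C\<close>, that is, it commutes with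
  \<open>C\<close> and is a power of it.\<close>

lemma bipartite_form_unique:
  assumes "bipartite_form col C \<Delta>" "bipartite_form col C \<Delta>'" and i: "i \<in> I"
  shows "\<exists>n. bvec I (lab \<Delta>') C i = (C ^^ n) (bvec I (lab \<Delta>) C i)"
proof -
  interpret A: bipartite_coxeter R I "lab \<Delta>" col C using assms by (simp add: bipartite_form_def)
  interpret B: bipartite_coxeter R I "lab \<Delta>'" col C using assms by (simp add: bipartite_form_def)
  have \<Delta>: "simple_system R \<Delta>" "simple_system R \<Delta>'" using assms by (auto simp: bipartite_form_def)
  obtain w where w: "w \<in> weyl_group R" "w ` \<Delta> = \<Delta>'"
    using weyl_transitive[OF A.simple_base_axioms B.simple_base_axioms] lab_image \<Delta> by auto
  have lab': "lab \<Delta>' j = (w \<circ> lab \<Delta>) j" if "j \<in> I" for j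
    using lab_weyl[OF \<Delta>(1) w(1) that] w(2) by simp
  have lin: "linear w" by (rule weyl_linear[OF w(1)])
  have "sum_refl (lab \<Delta>') J (w v) = w (sum_refl (lab \<Delta>) J v)" if "J \<subseteq> I" for J v
  proof -
    have "(\<Sum>j\<in>J. (w v \<bullet> lab \<Delta>' j) *\<^sub>R lab \<Delta>' j) = (\<Sum>j\<in>J. (v \<bullet> lab \<Delta> j) *\<^sub>R w (lab \<Delta> j))"
      using lab' that by (intro sum.cong) (auto simp: weyl_inner[OF w(1)])
    then show ?thesis
      by (simp add: sum_refl_def linear_diff[OF lin] linear_sum[OF lin] linear_scale[OF lin])
  qed
  then have "w (C v) = C (w v)" for v
    unfolding A.C[of v] B.C[of "w v"] by simp
  then obtain n where n: "\<forall>v. w v = (C ^^ n) v" using A.bvec_orbits(3)[OF w(1)] by blast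
  have "dual_basis I (lab \<Delta>') i = dual_basis I (w \<circ> lab \<Delta>) i"
    unfolding dual_basis_def using lab' by (simp cong: ball_cong)
  then have "dual_basis I (lab \<Delta>') i = w (dual_basis I (lab \<Delta>) i)"
    using A.dual_weyl[OF w(1) i] by simp
  then have "bvec I (lab \<Delta>') C i = w (bvec I (lab \<Delta>) C i)"
    using \<open>\<And>v. w (C v) = C (w v)\<close> by (simp add: bvec_def linear_diff[OF lin])
  then show ?thesis using n by auto
qed

end

theorem theorem4p7:
  fixes R :: "'a::euclidean_space set"
    and I :: "'i set"
    and lab :: "'a set \<Rightarrow> 'i \<Rightarrow> 'a"
    and C :: "'a \<Rightarrow> 'a"
  assumes "root_system R"
    and "reduced_roots R"
    and "irreducible_roots R"
    and "simply_laced R"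
    and "\<And>\<alpha>. \<alpha> \<in> R \<Longrightarrow> \<alpha> \<bullet> \<alpha> = 2"
    and "labelling R I lab"
    and "coxeter_element R C"
  shows "(\<forall>\<Delta>. compatible R I lab C \<Delta> \<longrightarrow>
            bij_betw (\<lambda>i. cyc_orbit C (beta I lab C \<Delta> i)) I (orbit_set R C)) \<and>
         (\<forall>\<Delta> \<Delta>'. compatible R I lab C \<Delta> \<longrightarrow> compatible R I lab C \<Delta>' \<longrightarrow>
            (\<forall>i\<in>I. cyc_orbit C (beta I lab C \<Delta> i) = cyc_orbit C (beta I lab C \<Delta>' i)))"
proof -
  interpret labelled_roots R I lab using assms by unfold_locales auto
  have "C \<in> weyl_group R"
    using assms(7) weyl_refl_prod by (auto simp: coxeter_element_def simple_system_def)
  then obtain N where N: "N > 0" "C ^^ N = id" by (rule weyl_finite_order)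
  have orbit: "cyc_orbit C (bvec I (lab \<Delta>1) C i) = cyc_orbit C (beta I lab C \<Delta> i)"
    if "\<exists>n. bvec I (lab \<Delta>1) C i = (C ^^ n) (beta I lab C \<Delta> i)" for \<Delta> \<Delta>1 i
    using that cyc_orbit_eq[OF N] by blast
  have compat: "simple_system R \<Delta>" "\<exists>is. expression_for I lab C \<Delta> is"
    if "compatible R I lab C \<Delta>" for \<Delta>
    using that by (auto simp: compatible_def)
  show ?thesis
  proof (intro conjI allI impI ballI)
    fix \<Delta> assume \<Delta>: "compatible R I lab C \<Delta>"
    obtain "is" where "is": "expression_for I lab C \<Delta> is" using compat[OF \<Delta>] by blast
    obtain col :: "'i \<Rightarrow> bool" where col: "\<forall>i\<in>I. \<forall>j\<in>I. lab \<Delta> i \<bullet> lab \<Delta> j = - 1 \<longrightarrow> col j = (\<not> col i)"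
      using simple_base.bipartite[OF lab_base[OF compat(1)[OF \<Delta>]]] by blast
    obtain \<Delta>1 where \<Delta>1: "bipartite_form col C \<Delta>1"
      "\<forall>k\<in>I. \<exists>n. bvec I (lab \<Delta>1) C k = (C ^^ n) (beta I lab C \<Delta> k)"
      using bipartite_form_exists[OF compat(1)[OF \<Delta>] "is" col] by blast
    show "bij_betw (\<lambda>i. cyc_orbit C (beta I lab C \<Delta> i)) I (orbit_set R C)"
    proof (rule bij_betw_cong[THEN iffD1, OF _ bipartite_form_bij[OF \<Delta>1(1)]])
      show "cyc_orbit C (bvec I (lab \<Delta>1) C i) = cyc_orbit C (beta I lab C \<Delta> i)" if "i \<in> I" for i
        using \<Delta>1(2) that by (intro orbit) blast
    qed
    fix \<Delta>' i assume \<Delta>': "compatible R I lab C \<Delta>'" and i: "i \<in> I"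
    obtain is' where is': "expression_for I lab C \<Delta>' is'" using compat[OF \<Delta>'] by blast
    obtain w where w: "w \<in> weyl_group R" "w ` \<Delta> = \<Delta>'"
      using weyl_transitive[OF lab_base[OF compat(1)[OF \<Delta>]] lab_base[OF compat(1)[OF \<Delta>']]]
      unfolding lab_image[OF compat(1)[OF \<Delta>]] lab_image[OF compat(1)[OF \<Delta>']] by blast
    \<comment> \<open>The labelled diagrams agree, so the colouring found for
      \<open>\<Delta>\<close> also serves \<open>\<Delta>'\<close>, and both bipartite forms share
      it.\<close>
    have "lab \<Delta>' i \<bullet> lab \<Delta>' j = lab \<Delta> i \<bullet> lab \<Delta> j" if "i \<in> I" "j \<in> I" for i j
      using lab_weyl[OF compat(1)[OF \<Delta>] w(1)] that unfolding w(2) by (simp add: weyl_inner[OF w(1)])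
    then have col': "\<forall>i\<in>I. \<forall>j\<in>I. lab \<Delta>' i \<bullet> lab \<Delta>' j = - 1 \<longrightarrow> col j = (\<not> col i)" using col by simp
    obtain \<Delta>1' where \<Delta>1': "bipartite_form col C \<Delta>1'"
      "\<forall>k\<in>I. \<exists>n. bvec I (lab \<Delta>1') C k = (C ^^ n) (beta I lab C \<Delta>' k)"
      using bipartite_form_exists[OF compat(1)[OF \<Delta>'] is' col'] by blast
    have "cyc_orbit C (beta I lab C \<Delta> i) = cyc_orbit C (bvec I (lab \<Delta>1) C i)"
      using \<Delta>1(2) i by (intro orbit[symmetric]) blast
    also have "\<dots> = cyc_orbit C (bvec I (lab \<Delta>1') C i)"
      using bipartite_form_unique[OF \<Delta>1(1) \<Delta>1'(1) i] cyc_orbit_eq[OF N] by blast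
    also have "\<dots> = cyc_orbit C (beta I lab C \<Delta>' i)"
      using \<Delta>1'(2) i by (intro orbit) blast
    finally show "cyc_orbit C (beta I lab C \<Delta> i) = cyc_orbit C (beta I lab C \<Delta>' i)" .
  qed
qed

end
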